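(* There exist $\varepsilon_0>0$ and constants $\lambda>0$, $M>0$ (independent of $\varepsilon$) such that for every $0<\varepsilon\le\varepsilon_0$ there exist real-analytic functions $\Psi_\varepsilon\in C^\omega(\mathbb{T}^2)$ and $F_\varepsilon\in C^\omega(\mathbb{R})$ satisfying $$\Delta\Psi_\varepsilon=F_\varepsilon(\Psi_\varepsilon)\quad\text{on }\mathbb{T}^2,\qquad \|\cos(y)-\Psi_\varepsilon\|_{\mathcal{G}^\lambda(\mathbb{T}^2)}\le M\varepsilon,$$ and, as $\varepsilon\to0$, $$\langle\Psi_\varepsilon,\cos(x)\cos(4y)\rangle=-\varepsilon^2\frac{\pi^2}{128}+O(\varepsilon^3).$$ Consequently, arbitrarily close to the Kolmogorov flow $U_K=(\sin y,0)$ (whose stream function is $\cos y$) there are families of stationary solutions $U_\varepsilon:=\nabla^\perp\Psi_\varepsilon:\mathbb{T}^2\to\mathbb{R}^2$ of the incompressible 2d Euler equations which are not shear flows and which are non-trivial in the sense that they do not lie in the kernel of $\mathcal{L}_K$, i.e. the vorticity $\Delta\Psi_\varepsilon\notin\ker\mathcal{L}_K$.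
   Context: $\mathbb{T}^2=(\mathbb{R}/2\pi\mathbb{Z})^2$ is the square torus with coordinates $(x,y)$; $\langle f,g\rangle=\int_{\mathbb{T}^2}fg\,dx\,dy$; $\nabla^\perp=(-\partial_y,\partial_x)$. The 2d Euler equations are $\partial_tU+(U\cdot\nabla)U+\nabla P=0$, $\nabla\cdot U=0$; in terms of the vorticity $\Omega=\partial_xU_2-\partial_yU_1$ and stream function $\Psi$ they read $\partial_t\Omega+U\cdot\nabla\Omega=0$, $U=\nabla^\perp\Psi$, $\Delta\Psi=\Omega$. A shear flow is one whose stream function depends on only one of the two spatial variables. For $\lambda>0$, $\mathcal{G}^\lambda(\mathbb{T}^2)$ is the Gevrey-1 space of $f\in L^2(\mathbb{T}^2)$ with $\|f\|_{\mathcal{G}^\lambda}:=\|e^{\lambda|k|}\hat f(k)\|_{\ell^2(k\in\mathbb{Z}^2)}<\infty$. $\mathcal{L}_K:=\sin(y)(1+\Delta^{-1})\partial_x$ is the linearized operator (acting on vorticities) at $U_K$; its kernel consists of the sums of functions in $\mathrm{span}\{\cos x,\sin x\}$ and functions $f\in L^2$ with $\partial_xf\equiv0$. *)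

theory Defs
  imports "HOL-Analysis.Analysis" "HOL-Library.Landau_Symbols"
begin

text \<open>Functions on the torus of side \<open>2\<pi>\<close> are the doubly periodic functions on the plane;
  integrals over the torus are taken over the fundamental cell.\<close>

definition torus_fun :: "(real \<times> real \<Rightarrow> 'a) \<Rightarrow> bool" where
  "torus_fun f \<longleftrightarrow>
     (\<forall>x y. f (x + 2 * pi, y) = f (x, y) \<and> f (x, y + 2 * pi) = f (x, y))"

definition torus_cell :: "(real \<times> real) set" where
  "torus_cell = {0..2 * pi} \<times> {0..2 * pi}"

definition torus_L2 :: "(real \<times> real \<Rightarrow> real) set" where
  "torus_L2 = {f. torus_fun f \<and> f \<in> borel_measurable (lebesgue_on torus_cell) \<and>
     integrable (lebesgue_on torus_cell) (\<lambda>p. (f p)\<^sup>2)}"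

definition torus_inner :: "(real \<times> real \<Rightarrow> real) \<Rightarrow> (real \<times> real \<Rightarrow> real) \<Rightarrow> real" where
  "torus_inner f g = (LINT p|lebesgue_on torus_cell. f p * g p)"

definition fourier_coeff :: "(real \<times> real \<Rightarrow> real) \<Rightarrow> int \<times> int \<Rightarrow> complex" where
  "fourier_coeff f = (\<lambda>(k, l).
     (LINT p|lebesgue_on torus_cell.
        of_real (f p) * cis (- (of_int k * fst p + of_int l * snd p))) / of_real (4 * pi\<^sup>2))"

definition freq_norm :: "int \<times> int \<Rightarrow> real" where
  "freq_norm = (\<lambda>(k, l). sqrt ((of_int k)\<^sup>2 + (of_int l)\<^sup>2))"

definition gevrey_space :: "real \<Rightarrow> (real \<times> real \<Rightarrow> real) set" where
  "gevrey_space r = {f \<in> torus_L2.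
     (\<lambda>k. (exp (r * freq_norm k) * cmod (fourier_coeff f k))\<^sup>2) summable_on UNIV}"

text \<open>Meaningful only for members of \<^const>\<open>gevrey_space\<close>: a divergent sum has value 0.\<close>

definition gevrey_norm :: "real \<Rightarrow> (real \<times> real \<Rightarrow> real) \<Rightarrow> real" where
  "gevrey_norm r f =
     sqrt (\<Sum>\<^sub>\<infinity>k\<in>UNIV. (exp (r * freq_norm k) * cmod (fourier_coeff f k))\<^sup>2)"

definition real_analytic :: "(real \<Rightarrow> real) \<Rightarrow> bool" where
  "real_analytic f \<longleftrightarrow> (\<forall>x0. \<exists>r>0. \<exists>a :: nat \<Rightarrow> real. \<forall>x. \<bar>x - x0\<bar> < r \<longrightarrow>
     (\<lambda>n. a n * (x - x0) ^ n) sums f x)"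

definition real_analytic2 :: "(real \<times> real \<Rightarrow> real) \<Rightarrow> bool" where
  "real_analytic2 f \<longleftrightarrow> (\<forall>x0 y0. \<exists>r>0. \<exists>a :: nat \<Rightarrow> nat \<Rightarrow> real.
     \<forall>x y. \<bar>x - x0\<bar> < r \<and> \<bar>y - y0\<bar> < r \<longrightarrow>
       ((\<lambda>(m, n). a m n * (x - x0) ^ m * (y - y0) ^ n) has_sum f (x, y)) UNIV)"

definition dx :: "(real \<times> real \<Rightarrow> real) \<Rightarrow> real \<times> real \<Rightarrow> real" where
  "dx f = (\<lambda>(x, y). deriv (\<lambda>s. f (s, y)) x)"

definition dy :: "(real \<times> real \<Rightarrow> real) \<Rightarrow> real \<times> real \<Rightarrow> real" where
  "dy f = (\<lambda>(x, y). deriv (\<lambda>s. f (x, s)) y)"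

definition laplacian :: "(real \<times> real \<Rightarrow> real) \<Rightarrow> real \<times> real \<Rightarrow> real" where
  "laplacian f = (\<lambda>p. dx (dx f) p + dy (dy f) p)"

definition grad_perp :: "(real \<times> real \<Rightarrow> real) \<Rightarrow> real \<times> real \<Rightarrow> real \<times> real" where
  "grad_perp f = (\<lambda>p. (- dy f p, dx f p))"

definition C1_fun :: "(real \<times> real \<Rightarrow> real) \<Rightarrow> bool" where
  "C1_fun f \<longleftrightarrow>
     (\<forall>p. f differentiable (at p)) \<and> continuous_on UNIV (dx f) \<and> continuous_on UNIV (dy f)"

definition euler_solution ::
  "(real \<Rightarrow> real \<times> real \<Rightarrow> real \<times> real) \<Rightarrow> (real \<Rightarrow> real \<times> real \<Rightarrow> real) \<Rightarrow> bool" where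
  "euler_solution U P \<longleftrightarrow>
     (\<forall>t. torus_fun (U t) \<and> torus_fun (P t) \<and>
        C1_fun (fst \<circ> U t) \<and> C1_fun (snd \<circ> U t) \<and> C1_fun (P t)) \<and>
     (\<forall>t p. (\<lambda>s. U s p) differentiable (at t)) \<and>
     (\<forall>t p.
        deriv (\<lambda>s. fst (U s p)) t
          + fst (U t p) * dx (fst \<circ> U t) p + snd (U t p) * dy (fst \<circ> U t) p
          + dx (P t) p = 0 \<and>
        deriv (\<lambda>s. snd (U s p)) t
          + fst (U t p) * dx (snd \<circ> U t) p + snd (U t p) * dy (snd \<circ> U t) p
          + dy (P t) p = 0 \<and>
        dx (fst \<circ> U t) p + dy (snd \<circ> U t) p = 0)"

definition stationary_euler :: "(real \<times> real \<Rightarrow> real \<times> real) \<Rightarrow> bool" where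
  "stationary_euler U \<longleftrightarrow> (\<exists>P. euler_solution (\<lambda>t. U) (\<lambda>t. P))"

definition shear_flow :: "(real \<times> real \<Rightarrow> real \<times> real) \<Rightarrow> bool" where
  "shear_flow U \<longleftrightarrow> (\<exists>\<psi>. torus_fun \<psi> \<and> C1_fun \<psi> \<and> U = grad_perp \<psi> \<and>
     ((\<exists>g. \<forall>x y. \<psi> (x, y) = g x) \<or> (\<exists>g. \<forall>x y. \<psi> (x, y) = g y)))"

definition kolmogorov_flow :: "real \<times> real \<Rightarrow> real \<times> real" where
  "kolmogorov_flow = (\<lambda>(x, y). (sin y, 0))"

text \<open>The operator \<open>\<L> = sin(y) (1 + \<Delta>\<^sup>-\<^sup>1) \<partial>\<^sub>x\<close> maps square integrable functions to
  distributions, so it is given by its action on Fourier coefficients. Here \<open>\<Delta>\<^sup>-\<^sup>1\<close> is the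
  inverse Laplacian on mean-free distributions (the range of \<open>\<partial>\<^sub>x\<close> is mean-free), and
  multiplication by \<open>sin y = (e\<^sup>i\<^sup>y - e\<^sup>-\<^sup>i\<^sup>y) / (2i)\<close> is a difference of
  shifts in the second frequency.\<close>

definition dx_hat :: "(int \<times> int \<Rightarrow> complex) \<Rightarrow> int \<times> int \<Rightarrow> complex" where
  "dx_hat c = (\<lambda>(k, l). \<i> * of_int k * c (k, l))"

definition inv_laplacian_hat :: "(int \<times> int \<Rightarrow> complex) \<Rightarrow> int \<times> int \<Rightarrow> complex" where
  "inv_laplacian_hat c =
     (\<lambda>(k, l). if (k, l) = (0, 0) then 0 else - c (k, l) / of_int (k\<^sup>2 + l\<^sup>2))"

definition sin_y_hat :: "(int \<times> int \<Rightarrow> complex) \<Rightarrow> int \<times> int \<Rightarrow> complex" where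
  "sin_y_hat c = (\<lambda>(k, l). (c (k, l - 1) - c (k, l + 1)) / (2 * \<i>))"

definition LK_hat :: "(int \<times> int \<Rightarrow> complex) \<Rightarrow> int \<times> int \<Rightarrow> complex" where
  "LK_hat c = sin_y_hat (\<lambda>k. dx_hat c k + inv_laplacian_hat (dx_hat c) k)"

definition ker_LK :: "(real \<times> real \<Rightarrow> real) set" where
  "ker_LK = {f \<in> torus_L2. \<forall>k. LK_hat (fourier_coeff f) k = 0}"

end

theory Submission
  imports Defs
begin

text \<open>Put \<open>F(z) = \<epsilon> f(z) - z\<close> with an odd quintic \<open>f\<close> and look for
  \<open>\<Psi> = V(y) + \<epsilon> W(x, y)\<close> with \<open>V = cos y + \<epsilon> v\<close>, \<open>W = cos x + \<epsilon> w\<close>. Then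
  \<open>(\<Delta> + 1) v\<close> is the \<open>x\<close>-mean of \<open>f(V + \<epsilon> W)\<close> and \<open>(\<Delta> + 1) w\<close> is the oscillating part of
  \<open>(f(V + \<epsilon> W) - f(V)) / \<epsilon>\<close>. Among functions invariant under \<open>(x, y) \<mapsto> (-x, -y)\<close> the kernel of
  \<open>\<Delta> + 1\<close> is spanned by \<open>cos x\<close> and \<open>cos y\<close>, so two solvability conditions remain. At
  \<open>\<epsilon> = 0\<close> they say that \<open>f(cos y)\<close> has no \<open>cos y\<close> mode and that \<open>f'(cos y)\<close> has mean zero, which
  \<open>f(z) = z\<^sup>5 / 5 - z\<^sup>3 / 3 + z / 8\<close> satisfies; for \<open>\<epsilon> > 0\<close> they are met by
  adjusting the coefficients of \<open>z\<^sup>3\<close> and \<open>z\<close> by \<open>O(\<epsilon>)\<close>. Everything is a polynomial fixed point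
  equation in a Banach algebra of cosine series with exponentially weighted summable coefficients, on
  which \<open>(\<Delta> + 1)\<^sup>-\<^sup>1\<close> is bounded, and it is solved by contraction.
  Since \<open>f'(cos y) = cos (4 y) / 8\<close>, the leading part of
  \<open>\<epsilon>\<^sup>2 w\<close> is \<open>- (\<epsilon>\<^sup>2 / 128) cos x cos (4 y)\<close>.\<close>

section \<open>Trigonometric series with exponentially decaying coefficients\<close>

text \<open>The quintic comes from a Chebyshev polynomial. For odd f, f'(cos y) contains even
  harmonics only; if a is its mean and b its cos (2 y) coefficient, the cos y mode of f(cos y) is a
  - b / 2. The two solvability conditions thus force a = b = 0. No nonzero odd cubic achieves this,
  and the first choice is a multiple of T_4: here f' = T_4 / 8. On the other hand odd cubics realise
  every pair (a, b), which is why correcting the two lower coefficients suffices. The obstacle is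
  that the condition at cos x degenerates: the amplitude of cos x in the stream function is
  \<epsilon>, so the cos x mode of f(\<Psi>) is O(\<epsilon>) whatever f is. Splitting off V, which
  is free of x, cures this: f(V) has no oscillating part, so the condition can be divided by
  \<epsilon> before it is solved. The square of cos x cos (4 y) integrates to pi^2, which turns
  1/128 into pi^2 / 128. The family is chosen separately for each \<epsilon>; only the bounds are
  uniform.\<close>

definition phase :: "int \<times> int \<Rightarrow> real \<times> real \<Rightarrow> real" where
  "phase k p = of_int (fst k) * fst p + of_int (snd k) * snd p"

definition freq_l1 :: "int \<times> int \<Rightarrow> real" where
  "freq_l1 k = \<bar>of_int (fst k)\<bar> + \<bar>of_int (snd k)\<bar>"

definition trig_series :: "(int \<times> int \<Rightarrow> complex) \<Rightarrow> real \<times> real \<Rightarrow> real" where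
  "trig_series c p = (\<Sum>\<^sub>\<infinity>k. Re (c k * cis (phase k p)))"

definition exp_decay :: "(int \<times> int \<Rightarrow> complex) \<Rightarrow> bool" where
  "exp_decay c \<longleftrightarrow> (\<exists>r>0. (\<lambda>k. exp (r * freq_l1 k) * cmod (c k)) summable_on UNIV)"

lemma phase_add: "phase k (p + q) = phase k p + phase k q"
  by (simp add: phase_def algebra_simps)

lemma phase_add_left: "phase (k + m) p = phase k p + phase m p"
  by (simp add: phase_def algebra_simps)

lemma phase_minus_left [simp]: "phase (- k) p = - phase k p"
  by (simp add: phase_def)

lemma freq_l1_nonneg [simp]: "0 \<le> freq_l1 k"
  by (simp add: freq_l1_def)

lemma freq_l1_add: "freq_l1 (k + m) \<le> freq_l1 k + freq_l1 m"
  by (simp add: freq_l1_def)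

lemma abs_phase_le: "\<bar>phase k h\<bar> \<le> freq_l1 k * norm h"
proof -
  have "\<bar>phase k h\<bar> \<le> \<bar>of_int (fst k)\<bar> * \<bar>fst h\<bar> + \<bar>of_int (snd k)\<bar> * \<bar>snd h\<bar>"
    unfolding phase_def using abs_triangle_ineq by (metis abs_mult)
  also have "\<dots> \<le> \<bar>of_int (fst k)\<bar> * norm h + \<bar>of_int (snd k)\<bar> * norm h"
    using norm_fst_le[of "fst h" "snd h"] norm_snd_le[of "snd h" "fst h"]
    by (intro add_mono mult_left_mono) auto
  finally show ?thesis
    by (simp add: freq_l1_def algebra_simps)
qed

text \<open>A power of the frequency is absorbed by half of the exponential rate. As
  \<open>exp_decay\<close> leaves the rate open, it is therefore stable under
  differentiation.\<close>

lemma exp_decay_weighted: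
  assumes "exp_decay c" "\<And>k. cmod (d k) \<le> freq_l1 k ^ n * cmod (c k)"
  shows "exp_decay d"
proof -
  obtain r where r: "r > 0" and s: "(\<lambda>k. exp (r * freq_l1 k) * cmod (c k)) summable_on UNIV"
    using assms(1) unfolding exp_decay_def by blast
  \<comment> \<open>The n-th power of the bound t \<le> exp t at t = r x / (2 n); for n = 0 the
    value is \<open>0 ^ 0 = 1\<close>, as required.\<close>
  define C where "C = (2 * of_nat n / r) ^ n"
  have C0: "0 \<le> C" using r by (simp add: C_def)
  have pow: "x ^ n \<le> C * exp (r / 2 * x)" if "0 \<le> x" for x :: real
  proof (cases "n = 0")
    case False
    then have n: "real n > 0" by simp
    have "r / (2 * n) * x \<le> exp (r / (2 * n) * x)"
      using exp_ge_add_one_self[of "r / (2 * n) * x"] by linarith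
    then have "x \<le> 2 * n / r * exp (r / (2 * n) * x)"
      using r n by (simp add: field_simps)
    then have "x ^ n \<le> (2 * n / r * exp (r / (2 * n) * x)) ^ n"
      using that by (intro power_mono)
    also have "\<dots> = C * exp (n * (r / (2 * n) * x))"
      by (simp only: C_def power_mult_distrib exp_of_nat_mult[symmetric]) (simp add: power_divide)
    also have "n * (r / (2 * n) * x) = r / 2 * x"
      using n by simp
    finally show ?thesis .
  qed (use that r C_def in auto)
  have "(\<lambda>k. exp (r / 2 * freq_l1 k) * cmod (d k)) summable_on UNIV"
  proof (rule summable_on_comparison_test)
    show "(\<lambda>k. C * (exp (r * freq_l1 k) * cmod (c k))) summable_on UNIV"
      using s by (rule summable_on_cmult_right)
    fix k
    have "exp (r / 2 * freq_l1 k) * cmod (d k) \<le>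
        exp (r / 2 * freq_l1 k) * ((C * exp (r / 2 * freq_l1 k)) * cmod (c k))"
      using assms(2)[of k] mult_right_mono[OF pow[OF freq_l1_nonneg[of k]] norm_ge_zero[of "c k"]]
      by (intro mult_left_mono) auto
    also have "\<dots> = C * ((exp (r / 2 * freq_l1 k) * exp (r / 2 * freq_l1 k)) * cmod (c k))"
      by simp
    also have "exp (r / 2 * freq_l1 k) * exp (r / 2 * freq_l1 k) = exp (r * freq_l1 k)"
      by (simp flip: exp_add)
    finally show "exp (r / 2 * freq_l1 k) * cmod (d k) \<le> C * (exp (r * freq_l1 k) * cmod (c k))" .
  qed auto
  then show ?thesis
    using r unfolding exp_decay_def by (intro exI[of _ "r / 2"]) auto
qed

lemma exp_decay_summable:
  assumes "exp_decay c"
  shows "(\<lambda>k. cmod (c k)) summable_on UNIV"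
proof -
  obtain r where r: "r > 0" and s: "(\<lambda>k. exp (r * freq_l1 k) * cmod (c k)) summable_on UNIV"
    using assms unfolding exp_decay_def by blast
  have "1 * cmod (c k) \<le> exp (r * freq_l1 k) * cmod (c k)" for k
    using r by (intro mult_right_mono) auto
  then show ?thesis
    using s by (intro summable_on_comparison_test[OF s]) auto
qed

lemma exp_decay_weighted_summable:
  assumes "exp_decay c"
  shows "(\<lambda>k. freq_l1 k ^ n * cmod (c k)) summable_on UNIV"
proof -
  have "exp_decay (\<lambda>k. of_real (freq_l1 k ^ n) * c k)"
    using assms by (rule exp_decay_weighted[where n = n]) (simp add: norm_mult norm_power)
  from exp_decay_summable[OF this] show ?thesis
    by (simp add: norm_mult norm_power)
qed

lemma trig_series_summable:
  assumes "(\<lambda>k. cmod (c k)) summable_on UNIV"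
  shows "(\<lambda>k. Re (c k * cis (phase k p))) summable_on UNIV"
proof (rule summable_on_Re)
  show "(\<lambda>k. c k * cis (phase k p)) summable_on UNIV"
    by (rule abs_summable_summable) (use assms in \<open>simp add: norm_mult\<close>)
qed

lemma trig_series_has_sum:
  assumes "(\<lambda>k. cmod (c k)) summable_on UNIV"
  shows "((\<lambda>k. Re (c k * cis (phase k p))) has_sum trig_series c p) UNIV"
  unfolding trig_series_def using trig_series_summable[OF assms] by (rule has_sum_infsum)

section \<open>Termwise differentiation\<close>

lemma cis_quadratic_remainder: "cmod (cis t - 1 - \<i> * of_real t) \<le> t\<^sup>2"
  using Taylor_exp[of "\<i> * of_real t" 1]
  by (simp add: cis_conv_exp norm_mult power2_eq_square algebra_simps)

definition dx_coeff :: "(int \<times> int \<Rightarrow> complex) \<Rightarrow> int \<times> int \<Rightarrow> complex" where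
  "dx_coeff c k = \<i> * of_int (fst k) * c k"

definition dy_coeff :: "(int \<times> int \<Rightarrow> complex) \<Rightarrow> int \<times> int \<Rightarrow> complex" where
  "dy_coeff c k = \<i> * of_int (snd k) * c k"

lemma exp_decay_dx_coeff: "exp_decay c \<Longrightarrow> exp_decay (dx_coeff c)"
  by (erule exp_decay_weighted[where n = 1])
    (auto simp: dx_coeff_def norm_mult freq_l1_def intro!: mult_right_mono)

lemma exp_decay_dy_coeff: "exp_decay c \<Longrightarrow> exp_decay (dy_coeff c)"
  by (erule exp_decay_weighted[where n = 1])
    (auto simp: dy_coeff_def norm_mult freq_l1_def intro!: mult_right_mono)

text \<open>The first-order Taylor remainder of each mode is bounded by the square of its phase.
  These bounds sum to \<open>B\<close> times the square of \<open>norm h\<close>, so the derivative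
  of the sum is verified directly from the definition.\<close>

lemma trig_series_has_derivative:
  assumes "exp_decay c"
  shows "(trig_series c has_derivative
    (\<lambda>h. fst h * trig_series (dx_coeff c) p + snd h * trig_series (dy_coeff c) p)) (at p)"
proof -
  define D where "D = (\<lambda>h. fst h * trig_series (dx_coeff c) p + snd h * trig_series (dy_coeff c) p)"
  define B where "B = (\<Sum>\<^sub>\<infinity>k. freq_l1 k ^ 2 * cmod (c k))"
  have sB: "(\<lambda>k. freq_l1 k ^ 2 * cmod (c k)) summable_on UNIV"
    using assms by (rule exp_decay_weighted_summable)
  have rem: "\<bar>trig_series c (p + h) - trig_series c p - D h\<bar> \<le> B * (norm h)\<^sup>2" for h
  proof -
    have hs: "((\<lambda>k. Re (c k * cis (phase k (p + h))) - Re (c k * cis (phase k p))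
        - (fst h * Re (dx_coeff c k * cis (phase k p)) + snd h * Re (dy_coeff c k * cis (phase k p))))
        has_sum (trig_series c (p + h) - trig_series c p - D h)) UNIV"
      unfolding D_def diff_conv_add_uminus
      by (intro has_sum_add has_sum_uminusI has_sum_cmult_right trig_series_has_sum
          exp_decay_summable exp_decay_dx_coeff exp_decay_dy_coeff assms)
    show ?thesis
    proof (rule norm_infsum_le[OF hs, unfolded real_norm_def])
      show "((\<lambda>k. freq_l1 k ^ 2 * cmod (c k) * (norm h)\<^sup>2) has_sum B * (norm h)\<^sup>2) UNIV"
        unfolding B_def by (intro has_sum_cmult_left has_sum_infsum sB)
      fix k :: "int \<times> int"
      have "Re (c k * cis (phase k (p + h))) - Re (c k * cis (phase k p))
          - (fst h * Re (dx_coeff c k * cis (phase k p)) + snd h * Re (dy_coeff c k * cis (phase k p)))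
          = Re (c k * cis (phase k p) * (cis (phase k h) - 1 - \<i> * of_real (phase k h)))"
        by (simp add: phase_add dx_coeff_def dy_coeff_def cis_mult[symmetric] phase_def[of k h] algebra_simps)
      also have "\<bar>\<dots>\<bar> \<le> cmod (c k * cis (phase k p) * (cis (phase k h) - 1 - \<i> * of_real (phase k h)))"
        by (rule abs_Re_le_cmod)
      also have "\<dots> = cmod (c k) * cmod (cis (phase k h) - 1 - \<i> * of_real (phase k h))"
        by (simp add: norm_mult)
      also have "\<dots> \<le> cmod (c k) * (freq_l1 k * norm h)\<^sup>2"
      proof (rule mult_left_mono)
        have "(phase k h)\<^sup>2 \<le> (freq_l1 k * norm h)\<^sup>2"
          using abs_phase_le[of k h] by (metis abs_ge_zero power_mono power2_abs)
        then show "cmod (cis (phase k h) - 1 - \<i> * of_real (phase k h)) \<le> (freq_l1 k * norm h)\<^sup>2"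
          using cis_quadratic_remainder[of "phase k h"] by linarith
      qed simp
      finally show "\<bar>Re (c k * cis (phase k (p + h))) - Re (c k * cis (phase k p))
          - (fst h * Re (dx_coeff c k * cis (phase k p)) + snd h * Re (dy_coeff c k * cis (phase k p)))\<bar>
          \<le> freq_l1 k ^ 2 * cmod (c k) * (norm h)\<^sup>2"
        by (simp add: power_mult_distrib algebra_simps)
    qed
  qed
  have "(trig_series c has_derivative D) (at p)"
    unfolding has_derivative_at
  proof
    show "bounded_linear D"
      unfolding D_def by (intro bounded_linear_intros)
    show "(\<lambda>h. norm (trig_series c (p + h) - trig_series c p - D h) / norm h) \<midarrow>0\<rightarrow> 0"
    proof (rule tendsto_sandwich[where f = "\<lambda>_. 0" and h = "\<lambda>h. B * norm h"])
      have "norm (trig_series c (p + h) - trig_series c p - D h) / norm h \<le> B * norm h"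
        if "h \<noteq> 0" for h
        using rem[of h] that by (simp add: field_simps power2_eq_square)
      then show "\<forall>\<^sub>F h in at 0. norm (trig_series c (p + h) - trig_series c p - D h) / norm h \<le> B * norm h"
        by (auto simp: eventually_at_filter)
      show "((\<lambda>h::real \<times> real. B * norm h) \<longlongrightarrow> 0) (at 0)"
        by (auto intro!: tendsto_eq_intros)
    qed auto
  qed
  then show ?thesis
    by (simp add: D_def)
qed

lemma dx_eqI:
  assumes "(f has_derivative (\<lambda>h. fst h * a + snd h * b)) (at p)"
  shows "dx f p = a"
proof -
  have "((\<lambda>s. (s, snd p)) has_derivative (\<lambda>h. (h, 0))) (at (fst p))"
    by (auto intro!: derivative_eq_intros)
  from has_derivative_compose[OF this, of f "\<lambda>h. fst h * a + snd h * b"] assms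
  have "((\<lambda>s. f (s, snd p)) has_derivative (\<lambda>h. h * a)) (at (fst p))"
    by simp
  then show ?thesis
    unfolding dx_def by (auto simp: has_field_derivative_def mult_commute_abs split_beta intro!: DERIV_imp_deriv)
qed

lemma dy_eqI:
  assumes "(f has_derivative (\<lambda>h. fst h * a + snd h * b)) (at p)"
  shows "dy f p = b"
proof -
  have "((\<lambda>s. (fst p, s)) has_derivative (\<lambda>h. (0, h))) (at (snd p))"
    by (auto intro!: derivative_eq_intros)
  from has_derivative_compose[OF this, of f "\<lambda>h. fst h * a + snd h * b"] assms
  have "((\<lambda>s. f (fst p, s)) has_derivative (\<lambda>h. h * b)) (at (snd p))"
    by simp
  then show ?thesis
    unfolding dy_def by (auto simp: has_field_derivative_def mult_commute_abs split_beta intro!: DERIV_imp_deriv)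
qed

lemma dx_trig_series: "exp_decay c \<Longrightarrow> dx (trig_series c) = trig_series (dx_coeff c)"
  by (rule ext) (rule dx_eqI[OF trig_series_has_derivative])

lemma dy_trig_series: "exp_decay c \<Longrightarrow> dy (trig_series c) = trig_series (dy_coeff c)"
  by (rule ext) (rule dy_eqI[OF trig_series_has_derivative])

lemma continuous_on_trig_series: "exp_decay c \<Longrightarrow> continuous_on A (trig_series c)"
  by (meson trig_series_has_derivative continuous_at_imp_continuous_on has_derivative_continuous)

lemma torus_fun_trig_series: "torus_fun (trig_series c)"
proof -
  have "cis (phase k (x + 2 * pi, y)) = cis (phase k (x, y))" for k x y
    using cis_multiple_2pi[of "of_int (fst k)"]
    by (simp add: phase_def algebra_simps flip: cis_mult)
  moreover have "cis (phase k (x, y + 2 * pi)) = cis (phase k (x, y))" for k x y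
    using cis_multiple_2pi[of "of_int (snd k)"]
    by (simp add: phase_def algebra_simps flip: cis_mult)
  ultimately show ?thesis
    by (simp add: torus_fun_def trig_series_def)
qed

lemma laplacian_trig_series:
  assumes "exp_decay c"
  shows "laplacian (trig_series c) = trig_series (\<lambda>k. - of_int ((fst k)\<^sup>2 + (snd k)\<^sup>2) * c k)"
proof -
  have "laplacian (trig_series c) p = trig_series (\<lambda>k. - of_int ((fst k)\<^sup>2 + (snd k)\<^sup>2) * c k) p" for p
  proof -
    have "((\<lambda>k. Re (dx_coeff (dx_coeff c) k * cis (phase k p)) + Re (dy_coeff (dy_coeff c) k * cis (phase k p)))
      has_sum laplacian (trig_series c) p) UNIV"
      unfolding laplacian_def dx_trig_series[OF assms] dy_trig_series[OF assms]
        dx_trig_series[OF exp_decay_dx_coeff[OF assms]] dy_trig_series[OF exp_decay_dy_coeff[OF assms]]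
      by (intro has_sum_add trig_series_has_sum exp_decay_summable exp_decay_dx_coeff exp_decay_dy_coeff assms)
    then show ?thesis
      unfolding trig_series_def
      by (intro infsumI[symmetric]) (simp add: dx_coeff_def dy_coeff_def power2_eq_square algebra_simps)
  qed
  then show ?thesis by blast
qed

section \<open>Products of absolutely convergent sums and real analyticity\<close>

lemma norm_summable_on_times:
  fixes f :: "'a \<Rightarrow> 'c :: {real_normed_field, banach}" and g :: "'b \<Rightarrow> 'c"
  assumes "(\<lambda>x. norm (f x)) summable_on A" "(\<lambda>y. norm (g y)) summable_on B"
  shows "(\<lambda>p. norm (f (fst p) * g (snd p))) summable_on A \<times> B"
proof (rule Infinite_Sum.abs_summable_on_Sigma_iff[THEN iffD2], intro conjI ballI)
  show "(\<lambda>y. norm (f (fst (x, y)) * g (snd (x, y)))) summable_on B" for x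
    using assms(2) by (auto simp: norm_mult intro: summable_on_cmult_right)
  show "(\<lambda>x. norm (\<Sum>\<^sub>\<infinity>y\<in>B. norm (f (fst (x, y)) * g (snd (x, y))))) summable_on A"
    using summable_on_cmult_left[OF assms(1)] by (simp add: norm_mult infsum_cmult_right' infsum_nonneg)
qed

lemma has_sum_times:
  fixes f :: "'a \<Rightarrow> 'c :: {real_normed_field, banach}" and g :: "'b \<Rightarrow> 'c"
  assumes "(f has_sum S) A" "(g has_sum T) B"
    and "(\<lambda>x. norm (f x)) summable_on A" "(\<lambda>y. norm (g y)) summable_on B"
  shows "((\<lambda>(x, y). f x * g y) has_sum S * T) (A \<times> B)"
proof -
  have "(\<lambda>(x, y). f x * g y) summable_on A \<times> B"
    using norm_summable_on_times[OF assms(3,4)] unfolding case_prod_unfold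
    by (rule Infinite_Sum.abs_summable_summable)
  then show ?thesis
    using has_sum_SigmaI[OF _ has_sum_cmult_left[OF assms(1), of T], of "\<lambda>(x, y). f x * g y" "\<lambda>_. B"]
      has_sum_cmult_right[OF assms(2)] by auto
qed

text \<open>Every mode is expanded at \<open>(x0, y0)\<close>. The moduli in the resulting sum over
  k, m, n add up to at most the sum of \<open>exp (r * freq_l1 k) * cmod (c k)\<close>, so the decay
  rate serves as radius and the order of summation can be exchanged.\<close>

lemma real_analytic2_trig_series:
  assumes "exp_decay c"
  shows "real_analytic2 (trig_series c)"
  unfolding real_analytic2_def
proof (intro allI)
  fix x0 y0 :: real
  obtain r where r: "r > 0" and s: "(\<lambda>k. exp (r * freq_l1 k) * cmod (c k)) summable_on UNIV"
    using assms unfolding exp_decay_def by blast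
  define b where "b k = c k * cis (phase k (x0, y0))" for k
  define t where "t k m n = b k * (\<i> * of_int (fst k)) ^ m / fact m * (\<i> * of_int (snd k)) ^ n / fact n"
    for k m n
  define a where "a m n = Re (\<Sum>\<^sub>\<infinity>k. t k m n)" for m n
  have "((\<lambda>(m, n). a m n * (x - x0) ^ m * (y - y0) ^ n) has_sum trig_series c (x, y)) UNIV"
    if xy: "\<bar>x - x0\<bar> < r" "\<bar>y - y0\<bar> < r" for x y
  proof -
    define G where "G = (\<lambda>(k, m, n). t k m n * of_real ((x - x0) ^ m * (y - y0) ^ n))"
    have exp_sum: "((\<lambda>n. z ^ n / fact n) has_sum exp z) UNIV" for z :: complex
    proof -
      have "summable (\<lambda>n. norm (z ^ n / fact n))"
        using summable_norm_exp[of z] by (simp add: divide_inverse mult.commute norm_mult norm_inverse)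
      moreover have "(\<lambda>n. z ^ n / fact n) sums exp z"
        using exp_converges[of z] by (simp add: scaleR_conv_of_real divide_inverse mult.commute)
      ultimately show ?thesis by (rule norm_summable_imp_has_sum)
    qed
    have exp_sum_real: "((\<lambda>n. u ^ n / fact n) has_sum exp u) UNIV" if "0 \<le> u" for u :: real
      using exp_converges[of u] that
      by (intro sums_nonneg_imp_has_sum) (auto simp: scaleR_conv_of_real divide_inverse mult.commute)
    \<comment> \<open>The sum over \<open>(m, n)\<close> of the moduli of the Taylor terms of mode
      k, up to the factor \<open>cmod (b k)\<close>.\<close>
    define E where "E k = exp (\<bar>of_int (fst k) * (x - x0)\<bar>) * exp (\<bar>of_int (snd k) * (y - y0)\<bar>)"
      for k :: "int \<times> int"
    have norm_G: "((\<lambda>mn. norm (G (k, mn))) has_sum cmod (b k) * E k) UNIV" for k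
    proof -
      have "((\<lambda>(m, n). \<bar>of_int (fst k) * (x - x0)\<bar> ^ m / fact m * (\<bar>of_int (snd k) * (y - y0)\<bar> ^ n / fact n))
          has_sum E k) UNIV"
        unfolding E_def
        using has_sum_times[where A = UNIV and B = UNIV, OF exp_sum_real exp_sum_real]
          has_sum_imp_summable[OF exp_sum_real] by auto
      from has_sum_cmult_right[OF this, of "cmod (b k)"] show ?thesis
        by (rule has_sum_cong[THEN iffD1, rotated])
          (auto simp: G_def t_def norm_mult norm_power norm_divide power_mult_distrib abs_mult simp del: of_real_diff)
    qed
    have "(\<lambda>p. norm (G p)) summable_on UNIV \<times> UNIV"
    proof (rule Infinite_Sum.abs_summable_on_Sigma_iff[THEN iffD2], intro conjI ballI)
      show "(\<lambda>mn. norm (G (k, mn))) summable_on UNIV" for k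
        using norm_G has_sum_imp_summable by blast
      have le: "cmod (b k) * E k \<le> exp (r * freq_l1 k) * cmod (c k)" for k
      proof -
        have "E k = exp (\<bar>of_int (fst k)\<bar> * \<bar>x - x0\<bar> + \<bar>of_int (snd k)\<bar> * \<bar>y - y0\<bar>)"
          by (simp add: E_def exp_add abs_mult)
        also have "\<dots> \<le> exp (\<bar>of_int (fst k)\<bar> * r + \<bar>of_int (snd k)\<bar> * r)"
          using xy by (intro exp_le_cancel_iff[THEN iffD2] add_mono mult_left_mono) auto
        finally have "E k \<le> exp (r * freq_l1 k)"
          by (simp add: freq_l1_def algebra_simps)
        then show ?thesis
          by (simp add: b_def norm_mult mult.commute[of "cmod (c k)"] mult_right_mono)
      qed
      show "(\<lambda>k. norm (infsum (\<lambda>mn. norm (G (k, mn))) UNIV)) summable_on UNIV"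
        using infsumI[OF norm_G] le by (intro summable_on_comparison_test[OF s]) (auto simp: E_def)
    qed
    then have "G summable_on UNIV \<times> UNIV"
      by (rule Infinite_Sum.abs_summable_summable)
    then obtain S where S: "(G has_sum S) (UNIV \<times> UNIV)"
      by (auto simp: summable_on_def)
    have "((\<lambda>mn. G (k, mn)) has_sum c k * cis (phase k (x, y))) UNIV" for k
    proof -
      let ?z = "\<i> * of_int (fst k) * of_real (x - x0)" and ?w = "\<i> * of_int (snd k) * of_real (y - y0)"
      have "((\<lambda>(m, n). ?z ^ m / fact m * (?w ^ n / fact n)) has_sum exp ?z * exp ?w) UNIV"
        using has_sum_times[where A = UNIV and B = UNIV, OF exp_sum exp_sum]
          has_sum_imp_summable[OF exp_sum_real] by (auto simp: norm_divide norm_power)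
      from has_sum_cmult_right[OF this, of "b k"]
      have "((\<lambda>mn. G (k, mn)) has_sum b k * (exp ?z * exp ?w)) UNIV"
        by (rule has_sum_cong[THEN iffD1, rotated]) (auto simp: G_def t_def power_mult_distrib)
      moreover have "b k * (exp ?z * exp ?w) = c k * cis (phase k (x, y))"
      proof -
        have "exp ?z * exp ?w = cis (phase k (x, y) - phase k (x0, y0))"
          by (simp add: cis_conv_exp phase_def algebra_simps flip: exp_add)
        then show ?thesis
          by (simp add: b_def cis_divide[symmetric])
      qed
      ultimately show ?thesis by simp
    qed
    from has_sum_SigmaD[OF S this] have "((\<lambda>k. c k * cis (phase k (x, y))) has_sum S) UNIV"
      by simp
    from has_sum_Re[OF this] have ReS: "Re S = trig_series c (x, y)"
      unfolding trig_series_def by (rule infsumI[symmetric])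
    \<comment> \<open>Summing over \<open>(m, n)\<close> first gave the series itself; summing over
      k first gives the Taylor coefficients \<open>a m n\<close>.\<close>
    have swap: "((\<lambda>(mn, k). G (k, mn)) has_sum S) (UNIV \<times> UNIV)"
      using S by (rule has_sum_swap[THEN iffD1])
    have "(\<lambda>k. G (k, mn)) summable_on UNIV" for mn
      using has_sum_imp_summable[OF swap] by (rule summable_on_SigmaD1) simp
    then have "((\<lambda>k. case (mn, k) of (mn, k) \<Rightarrow> G (k, mn)) has_sum (\<Sum>\<^sub>\<infinity>k. G (k, mn))) UNIV" for mn
      by simp
    from has_sum_SigmaD[OF swap this]
    have "((\<lambda>mn. \<Sum>\<^sub>\<infinity>k. G (k, mn)) has_sum S) UNIV" .
    from has_sum_Re[OF this] have "((\<lambda>mn. Re (infsum (\<lambda>k. G (k, mn)) UNIV)) has_sum trig_series c (x, y)) UNIV"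
      by (simp add: ReS)
    moreover have "Re (infsum (\<lambda>k. G (k, mn)) UNIV) = (case mn of (m, n) \<Rightarrow> a m n * (x - x0) ^ m * (y - y0) ^ n)"
      for mn
      by (cases mn) (simp add: G_def a_def infsum_cmult_left' mult.assoc Re_complex_of_real
          flip: of_real_mult of_real_power of_real_diff)
    ultimately show ?thesis by simp
  qed
  then show "\<exists>r>0. \<exists>a. \<forall>x y. \<bar>x - x0\<bar> < r \<and> \<bar>y - y0\<bar> < r \<longrightarrow>
      ((\<lambda>(m, n). a m n * (x - x0) ^ m * (y - y0) ^ n) has_sum trig_series c (x, y)) UNIV"
    using r by blast
qed

section \<open>Fourier coefficients, inner products and Gevrey norms\<close>

lemma torus_cell_eq_cbox: "torus_cell = cbox (0, 0) (2 * pi, 2 * pi)"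
  by (simp add: torus_cell_def cbox_Pair_eq)

lemma continuous_integrable_torus_cell:
  fixes g :: "real \<times> real \<Rightarrow> 'a :: euclidean_space"
  assumes "continuous_on torus_cell g"
  shows "integrable (lebesgue_on torus_cell) g"
    "(LINT p|lebesgue_on torus_cell. g p) = integral torus_cell g"
proof -
  show *: "integrable (lebesgue_on torus_cell) g"
    using assms unfolding torus_cell_eq_cbox by (rule continuous_imp_integrable)
  show "(LINT p|lebesgue_on torus_cell. g p) = integral torus_cell g"
    using * by (rule lebesgue_integral_eq_integral) (simp add: torus_cell_eq_cbox)
qed

lemma continuous_on_phase [continuous_intros]: "continuous_on A (phase k)"
  unfolding phase_def by (intro continuous_intros)

lemma integral_cis_int:
  "integral {0..2 * pi} (\<lambda>x. cis (of_int n * x)) = (if n = 0 then of_real (2 * pi) else 0)"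
proof (cases "n = 0")
  case False
  have "((\<lambda>x. cis (of_int n * x)) has_integral
      (cis (of_int n * (2 * pi)) / (\<i> * of_int n) - cis (of_int n * 0) / (\<i> * of_int n))) {0..2 * pi}"
  proof (rule fundamental_theorem_of_calculus)
    fix x :: real
    have "((\<lambda>z. exp (\<i> * of_int n * z) / (\<i> * of_int n)) has_field_derivative exp (\<i> * of_int n * of_real x)) (at (of_real x))"
      using False by (auto intro!: derivative_eq_intros)
    from has_vector_derivative_real_field[OF this]
    show "((\<lambda>x. cis (of_int n * x) / (\<i> * of_int n)) has_vector_derivative cis (of_int n * x)) (at x within {0..2 * pi})"
      by (simp add: cis_conv_exp mult.assoc)
  qed simp
  then show ?thesis
    using False cis_multiple_2pi[of "of_int n"] by (auto simp: mult.commute dest!: integral_unique)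
qed (simp add: scaleR_conv_of_real)

lemma integral_cis_phase:
  "integral torus_cell (\<lambda>p. cis (phase m p)) = (if m = 0 then of_real (4 * pi\<^sup>2) else 0)"
proof -
  have "integral torus_cell (\<lambda>p. cis (phase m p)) =
      integral {0..2 * pi} (\<lambda>x. integral {0..2 * pi} (\<lambda>y. cis (of_int (fst m) * x) * cis (of_int (snd m) * y)))"
    unfolding torus_cell_eq_cbox
    by (subst integral_prod_continuous) (auto simp: phase_def cis_mult intro!: continuous_intros)
  also have "\<dots> = integral {0..2 * pi} (\<lambda>x. cis (of_int (fst m) * x)) *
      integral {0..2 * pi} (\<lambda>y. cis (of_int (snd m) * y))"
    by simp
  finally show ?thesis
    by (cases m) (auto simp: integral_cis_int power2_eq_square zero_prod_def)
qed

lemma fourier_coeff_eq: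
  "fourier_coeff f k = (LINT p|lebesgue_on torus_cell. of_real (f p) * cis (- phase k p)) / of_real (4 * pi\<^sup>2)"
  by (cases k) (simp add: fourier_coeff_def phase_def)

text \<open>The average appears because \<^const>\<open>trig_series\<close> takes real parts, which symmetrises the coefficients.\<close>

lemma fourier_coeff_trig_series:
  assumes "(\<lambda>k. cmod (c k)) summable_on UNIV"
  shows "fourier_coeff (trig_series c) k = (c k + cnj (c (- k))) / 2"
proof -
  define f where "f j p = of_real (Re (c j * cis (phase j p))) * cis (- phase k p)" for j p
  define g where "g p = of_real (trig_series c p) * cis (- phase k p)" for p
  \<comment> \<open>Re z = (z + cnj z) / 2 splits mode j into the frequencies j and - j, so the
    coefficient at k receives contributions from j = k and from j = - k.\<close>
  have f_exp: "f j p = c j / 2 * cis (phase (j - k) p) + cnj (c j) / 2 * cis (phase (- j - k) p)" for j p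
  proof -
    have "complex_of_real (Re (c j * cis (phase j p))) = (c j * cis (phase j p) + cnj (c j) * cis (- phase j p)) / 2"
      using complex_add_cnj[of "c j * cis (phase j p)"] by (simp add: cis_cnj)
    moreover have "cis (phase (j - k) p) = cis (phase j p) * cis (- phase k p)"
        "cis (phase (- j - k) p) = cis (- phase j p) * cis (- phase k p)"
      using phase_add_left[of j "- k" p] phase_add_left[of "- j" "- k" p] by (simp_all add: cis_mult)
    ultimately show ?thesis
      unfolding f_def by (simp add: distrib_left distrib_right mult_ac add_divide_distrib)
  qed
  have cont: "continuous_on A (f j)" for A j
    unfolding f_exp by (intro continuous_intros)
  have int_f: "integral torus_cell (f j) = 2 * pi\<^sup>2 * ((if j = k then c k else 0) + (if j = - k then cnj (c (- k)) else 0))"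
    for j
  proof -
    have 1: "(\<lambda>p. c j / 2 * cis (phase (j - k) p)) integrable_on torus_cell"
       "(\<lambda>p. cnj (c j) / 2 * cis (phase (- j - k) p)) integrable_on torus_cell"
      by (auto simp: torus_cell_eq_cbox intro!: integrable_continuous continuous_intros)
    have z: "j - k = 0 \<longleftrightarrow> j = k" "- j - k = 0 \<longleftrightarrow> j = - k"
      by (auto simp: algebra_simps)
    show ?thesis
      unfolding f_exp integral_add[OF 1] integral_mult_right integral_cis_phase z
      by (auto simp: algebra_simps)
  qed
  have ul: "uniform_limit torus_cell (\<lambda>F p. \<Sum>j\<in>F. f j p) (\<lambda>p. \<Sum>\<^sub>\<infinity>j. f j p) (finite_subsets_at_top UNIV)"
  proof (rule Weierstrass_m_test_general)
    show "norm (f j p) \<le> cmod (c j)" for j p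
      using abs_Re_le_cmod[of "c j * cis (phase j p)"] unfolding f_def norm_mult norm_of_real norm_cis by simp
  qed (use assms in auto)
  have g: "(\<Sum>\<^sub>\<infinity>j. f j p) = g p" for p
    unfolding f_def g_def
    by (intro infsumI has_sum_cmult_left has_sum_of_real trig_series_has_sum assms)
  have ul_cbox: "uniform_limit (cbox (0, 0) (2 * pi, 2 * pi)) (\<lambda>F p. \<Sum>j\<in>F. f j p) g (finite_subsets_at_top UNIV)"
    using ul g by (simp add: torus_cell_eq_cbox)
  have "continuous_on torus_cell (\<lambda>p. \<Sum>j\<in>F. f j p)" for F
    by (intro continuous_on_sum cont)
  then obtain I J where IJ: "\<And>F. ((\<lambda>p. \<Sum>j\<in>F. f j p) has_integral I F) torus_cell"
    "(g has_integral J) torus_cell" "(I \<longlongrightarrow> J) (finite_subsets_at_top UNIV)"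
    using uniform_limit_integral_cbox[OF ul_cbox] unfolding torus_cell_eq_cbox[symmetric]
    by (smt (verit, best) finite_subsets_at_top_neq_bot)
  have "I F = (\<Sum>j\<in>F. integral torus_cell (f j))" if "finite F" for F
  proof -
    have "((\<lambda>p. \<Sum>j\<in>F. f j p) has_integral (\<Sum>j\<in>F. integral torus_cell (f j))) torus_cell"
      using that cont
      by (intro has_integral_sum integrable_integral) (auto simp: torus_cell_eq_cbox intro!: integrable_continuous)
    with IJ(1) show ?thesis by (rule has_integral_unique)
  qed
  then have "((\<lambda>j. integral torus_cell (f j)) has_sum J) UNIV"
    unfolding has_sum_def
    by (intro tendsto_cong[THEN iffD1, OF _ IJ(3)] eventually_finite_subsets_at_top_weakI) auto
  moreover have "((\<lambda>j. integral torus_cell (f j)) has_sum 2 * pi\<^sup>2 * (c k + cnj (c (- k)))) UNIV"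
    unfolding int_f
    by (intro has_sum_cmult_right has_sum_add has_sum_finite_neutralI[of "{k}"] has_sum_finite_neutralI[of "{- k}"]) auto
  ultimately have J: "J = 2 * pi\<^sup>2 * (c k + cnj (c (- k)))"
    by (rule has_sum_unique)
  have "continuous_on torus_cell g"
  proof -
    have "uniform_limit torus_cell (\<lambda>F p. \<Sum>j\<in>F. f j p) g (finite_subsets_at_top UNIV)"
      using ul_cbox by (simp add: torus_cell_eq_cbox)
    then show ?thesis
      by (rule uniform_limit_theorem[rotated]) (use cont in \<open>auto intro!: always_eventually continuous_on_sum\<close>)
  qed
  from continuous_integrable_torus_cell(2)[OF this] integral_unique[OF IJ(2)] J
  have "(LINT p|lebesgue_on torus_cell. g p) = 2 * pi\<^sup>2 * (c k + cnj (c (- k)))"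
    by simp
  then show ?thesis
    by (simp add: fourier_coeff_eq g_def field_simps)
qed

lemma trig_series_torus_L2:
  assumes "exp_decay c"
  shows "trig_series c \<in> torus_L2"
proof -
  have "continuous_on torus_cell (trig_series c)"
    using assms by (rule continuous_on_trig_series)
  moreover from this have "integrable (lebesgue_on torus_cell) (\<lambda>p. (trig_series c p)\<^sup>2)"
    by (intro continuous_integrable_torus_cell continuous_intros)
  moreover have "torus_cell \<in> sets lebesgue"
    by (simp add: torus_cell_eq_cbox)
  ultimately show ?thesis
    by (simp add: torus_L2_def torus_fun_trig_series continuous_imp_measurable_on_sets_lebesgue)
qed

text \<open>The product of cosines is the mean of cos (m x + n y) and cos (m x - n y); the
  normalisation 4 pi^2 in \<open>fourier_coeff\<close> turns this mean into the factor 2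
  pi^2.\<close>

lemma torus_inner_cos_cos:
  assumes "exp_decay c"
  shows "torus_inner (trig_series c) (\<lambda>(x, y). cos (of_int m * x) * cos (of_int n * y)) =
    2 * pi\<^sup>2 * Re (fourier_coeff (trig_series c) (m, n) + fourier_coeff (trig_series c) (m, - n))"
proof -
  have int: "integrable (lebesgue_on torus_cell) (\<lambda>p. of_real (trig_series c p) * cis (- phase k p))" for k
    by (intro continuous_integrable_torus_cell continuous_intros continuous_on_trig_series assms)
  have "2 * pi\<^sup>2 * Re (fourier_coeff (trig_series c) (m, n) + fourier_coeff (trig_series c) (m, - n)) =
     Re ((LINT p|lebesgue_on torus_cell. of_real (trig_series c p) * cis (- phase (m, n) p)) +
      (LINT p|lebesgue_on torus_cell. of_real (trig_series c p) * cis (- phase (m, - n) p))) / 2"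
    unfolding fourier_coeff_eq by (simp add: field_simps flip: of_real_power of_real_mult)
  also have "\<dots> = (LINT p|lebesgue_on torus_cell. Re (of_real (trig_series c p) * cis (- phase (m, n) p)
      + of_real (trig_series c p) * cis (- phase (m, - n) p))) / 2"
    unfolding integral_Re[OF Bochner_Integration.integrable_add[OF int int]]
      Bochner_Integration.integral_add[OF int int] ..
  also have "\<dots> = torus_inner (trig_series c) (\<lambda>(x, y). cos (of_int m * x) * cos (of_int n * y))"
    unfolding torus_inner_def integral_divide_zero[symmetric]
    by (intro Bochner_Integration.integral_cong refl)
      (auto simp: phase_def cos_add cos_diff algebra_simps)
  finally show ?thesis by simp
qed

text \<open>The l2 norm of a sequence is at most its l1 norm, and the Euclidean length of a
  frequency is at most \<open>freq_l1\<close>. The symmetry of \<open>c\<close> ensures that its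
  values are the true Fourier coefficients.\<close>

lemma gevrey_trig_series:
  assumes "exp_decay c" "\<And>k. c (- k) = cnj (c k)"
    and s: "(\<lambda>k. exp (r * freq_l1 k) * cmod (c k)) summable_on UNIV" and "r \<ge> 0"
  shows "trig_series c \<in> gevrey_space r"
    and "gevrey_norm r (trig_series c) \<le> (\<Sum>\<^sub>\<infinity>k. exp (r * freq_l1 k) * cmod (c k))"
proof -
  let ?u = "\<lambda>k. exp (r * freq_l1 k) * cmod (c k)"
  let ?v = "\<lambda>k. exp (r * freq_norm k) * cmod (fourier_coeff (trig_series c) k)"
  define N where "N = (\<Sum>\<^sub>\<infinity>k. ?u k)"
  have fc: "fourier_coeff (trig_series c) k = c k" for k
    using fourier_coeff_trig_series[OF exp_decay_summable[OF assms(1)], of k] by (simp add: assms(2))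
  have norm_le: "freq_norm k \<le> freq_l1 k" for k
    using sqrt_sum_squares_le_sum_abs[of "of_int (fst k)" "of_int (snd k)"]
    unfolding freq_norm_def freq_l1_def by (simp add: case_prod_beta)
  have vu: "?v k \<le> ?u k" for k
    unfolding fc using \<open>r \<ge> 0\<close> norm_le[of k]
    by (intro mult_right_mono exp_le_cancel_iff[THEN iffD2] mult_left_mono) auto
  have uN: "?u k \<le> N" for k
    unfolding N_def using finite_sum_le_infsum[OF s, of "{k}"] by simp
  have vN: "?v k \<le> N" for k
    using vu uN by (rule order_trans)
  \<comment> \<open>Each entry is at most the total \<open>N\<close>, so one factor of the square is
    replaced by \<open>N\<close>; the squares then sum to at most the square of
    \<open>N\<close>.\<close>
  have le: "(?v k)\<^sup>2 \<le> N * ?u k" for k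
    unfolding power2_eq_square using order_trans[OF _ uN[of k]] by (intro mult_mono vN vu) auto
  have sN: "(\<lambda>k. N * ?u k) summable_on UNIV"
    using s by (rule summable_on_cmult_right)
  have sv: "(\<lambda>k. (?v k)\<^sup>2) summable_on UNIV"
    by (rule summable_on_comparison_test[OF sN le]) auto
  then show "trig_series c \<in> gevrey_space r"
    by (simp add: gevrey_space_def trig_series_torus_L2 assms(1))
  have "(\<Sum>\<^sub>\<infinity>k. (?v k)\<^sup>2) \<le> (\<Sum>\<^sub>\<infinity>k. N * ?u k)"
    using sv sN le by (rule infsum_mono)
  also have "\<dots> = N\<^sup>2"
    by (simp add: infsum_cmult_right' N_def power2_eq_square)
  finally have "gevrey_norm r (trig_series c) \<le> sqrt (N\<^sup>2)"
    unfolding gevrey_norm_def by (rule real_sqrt_le_mono)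
  also have "\<dots> = N"
    using order_trans[OF _ uN[of 0]] by simp
  finally show "gevrey_norm r (trig_series c) \<le> (\<Sum>\<^sub>\<infinity>k. ?u k)"
    by (simp add: N_def)
qed

section \<open>The Banach algebra of even functions\<close>

text \<open>Weighted summable real coefficients that are symmetric under \<open>k \<mapsto> - k\<close>; the product is
  convolution, i.e. pointwise multiplication of the represented functions.\<close>

typedef cos_alg = "{c :: int \<times> int \<Rightarrow> real.
    (\<forall>k. c (- k) = c k) \<and> (\<lambda>k. exp (freq_l1 k) * \<bar>c k\<bar>) summable_on UNIV}"
  morphisms coeff Abs_cos_alg
  by (rule exI[of _ "\<lambda>_. 0"]) simp

setup_lifting type_definition_cos_alg

lemma coeff_minus_arg [simp]: "coeff a (- k) = coeff a k"
  using coeff[of a] by blast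

lemma weighted_coeff_summable: "(\<lambda>k. exp (freq_l1 k) * \<bar>coeff a k\<bar>) summable_on UNIV"
  using coeff[of a] by blast

lemma abs_le_weighted: "\<bar>x\<bar> \<le> exp (freq_l1 k) * \<bar>x\<bar>"
  using mult_right_mono[of 1 "exp (freq_l1 k)" "\<bar>x\<bar>"] by simp

lemma coeff_abs_summable: "(\<lambda>k. \<bar>coeff a k\<bar>) summable_on UNIV"
  by (rule summable_on_comparison_test[OF weighted_coeff_summable[of a]]) (auto simp: abs_le_weighted)

lemma cos_alg_eqI: "(\<And>k. coeff a k = coeff b k) \<Longrightarrow> a = b"
  by (metis coeff_inject ext)

lemma weighted_summable_finite:
  "finite {k. c k \<noteq> 0} \<Longrightarrow> (\<lambda>k. exp (freq_l1 k) * \<bar>c k :: real\<bar>) summable_on UNIV"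
  by (rule finite_nonzero_values_imp_summable_on) simp

lemma weighted_summable_add:
  assumes "(\<lambda>k. exp (freq_l1 k) * \<bar>a k\<bar>) summable_on UNIV" "(\<lambda>k. exp (freq_l1 k) * \<bar>b k\<bar>) summable_on UNIV"
  shows "(\<lambda>k. exp (freq_l1 k) * \<bar>a k + b k :: real\<bar>) summable_on UNIV"
  by (rule summable_on_comparison_test[OF summable_on_add[OF assms]])
    (auto simp: abs_triangle_ineq simp flip: distrib_left)

lemma weighted_summable_scale:
  assumes "(\<lambda>k. exp (freq_l1 k) * \<bar>a k\<bar>) summable_on UNIV"
  shows "(\<lambda>k. exp (freq_l1 k) * \<bar>r * a k :: real\<bar>) summable_on UNIV"
  using summable_on_cmult_right[OF assms, of "\<bar>r\<bar>"] by (simp add: abs_mult mult_ac)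

instantiation cos_alg :: real_vector
begin
lift_definition zero_cos_alg :: cos_alg is "\<lambda>_. 0" by simp
lift_definition plus_cos_alg :: "cos_alg \<Rightarrow> cos_alg \<Rightarrow> cos_alg" is "\<lambda>a b k. a k + b k"
  by (simp add: weighted_summable_add)
lift_definition uminus_cos_alg :: "cos_alg \<Rightarrow> cos_alg" is "\<lambda>a k. - a k" by simp
lift_definition minus_cos_alg :: "cos_alg \<Rightarrow> cos_alg \<Rightarrow> cos_alg" is "\<lambda>a b k. a k - b k"
  using weighted_summable_add[of _ "\<lambda>k. - _ k"] by simp
lift_definition scaleR_cos_alg :: "real \<Rightarrow> cos_alg \<Rightarrow> cos_alg" is "\<lambda>r a k. r * a k"
  by (simp add: weighted_summable_scale)
instance
  by standard (transfer; simp add: algebra_simps)+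
end

lemmas [simp] =
  zero_cos_alg.rep_eq plus_cos_alg.rep_eq uminus_cos_alg.rep_eq minus_cos_alg.rep_eq scaleR_cos_alg.rep_eq

lemma infsum_nonneg_eq_0D:
  fixes f :: "'a \<Rightarrow> real"
  assumes "infsum f UNIV = 0" "f summable_on UNIV" "\<And>x. f x \<ge> 0"
  shows "f x = 0"
  using nonneg_infsum_le_0D[of f UNIV x] assms by simp

instantiation cos_alg :: real_normed_vector
begin
definition norm_cos_alg :: "cos_alg \<Rightarrow> real" where
  "norm_cos_alg a = (\<Sum>\<^sub>\<infinity>k. exp (freq_l1 k) * \<bar>coeff a k\<bar>)"
definition sgn_cos_alg :: "cos_alg \<Rightarrow> cos_alg" where
  "sgn_cos_alg a = inverse (norm a) *\<^sub>R a"
definition dist_cos_alg :: "cos_alg \<Rightarrow> cos_alg \<Rightarrow> real" where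
  "dist_cos_alg a b = norm (a - b)"
definition uniformity_cos_alg :: "(cos_alg \<times> cos_alg) filter" where
  "uniformity_cos_alg = (INF e\<in>{0<..}. principal {(x, y). dist x y < e})"
definition open_cos_alg :: "cos_alg set \<Rightarrow> bool" where
  "open_cos_alg U \<longleftrightarrow> (\<forall>x\<in>U. eventually (\<lambda>(x', y). x' = x \<longrightarrow> y \<in> U) uniformity)"
instance
proof
  fix a b :: cos_alg and r :: real
  show "norm a = 0 \<longleftrightarrow> a = 0"
  proof
    assume "norm a = 0"
    then have "exp (freq_l1 k) * \<bar>coeff a k\<bar> = 0" for k
      unfolding norm_cos_alg_def by (rule infsum_nonneg_eq_0D[OF _ weighted_coeff_summable]) auto
    then show "a = 0"
      by (intro cos_alg_eqI) simp
  qed (simp add: norm_cos_alg_def)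
  show "norm (a + b) \<le> norm a + norm b"
    unfolding norm_cos_alg_def infsum_add[OF weighted_coeff_summable weighted_coeff_summable, symmetric]
    by (intro infsum_mono weighted_coeff_summable summable_on_add)
      (auto simp: abs_triangle_ineq simp flip: distrib_left)
  show "norm (r *\<^sub>R a) = \<bar>r\<bar> * norm a"
    unfolding norm_cos_alg_def infsum_cmult_right'[symmetric]
    by (intro infsum_cong) (simp add: abs_mult)
qed (auto simp: sgn_cos_alg_def dist_cos_alg_def uniformity_cos_alg_def open_cos_alg_def)
end

lemma sum_weighted_coeff_le: "finite F \<Longrightarrow> (\<Sum>k\<in>F. exp (freq_l1 k) * \<bar>coeff a k\<bar>) \<le> norm a"
  unfolding norm_cos_alg_def by (rule finite_sum_le_infsum[OF weighted_coeff_summable]) auto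

lemma weighted_coeff_le: "exp (freq_l1 k) * \<bar>coeff a k\<bar> \<le> norm a"
  using sum_weighted_coeff_le[of "{k}" a] by simp

lemma abs_coeff_le: "\<bar>coeff a k\<bar> \<le> norm a"
  using abs_le_weighted weighted_coeff_le by (rule order_trans)

lemma bounded_linear_coeff: "bounded_linear (\<lambda>a. coeff a k)"
  by (rule bounded_linear_intro[of _ 1]) (auto simp: abs_coeff_le)

text \<open>The coefficients converge one by one. The Cauchy bound is passed to the limit in finite
  partial sums, where limit and sum commute, and then extended to the whole series.\<close>

instance cos_alg :: banach
proof
  fix X :: "nat \<Rightarrow> cos_alg"
  assume X: "Cauchy X"
  have "Cauchy (\<lambda>n. coeff (X n) k)" for k
    using bounded_linear.Cauchy[OF bounded_linear_coeff X] .
  then have "\<exists>l. (\<lambda>n. coeff (X n) k) \<longlonglongrightarrow> l" for k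
    by (simp add: Cauchy_convergent convergent_def[symmetric])
  then obtain c where c: "\<And>k. (\<lambda>n. coeff (X n) k) \<longlonglongrightarrow> c k"
    by metis
  have bnd: "\<exists>N. \<forall>n\<ge>N. \<forall>F. finite F \<longrightarrow> (\<Sum>k\<in>F. exp (freq_l1 k) * \<bar>c k - coeff (X n) k\<bar>) \<le> e" if "e > 0" for e
  proof -
    obtain N where N: "\<And>m n. m \<ge> N \<Longrightarrow> n \<ge> N \<Longrightarrow> norm (X m - X n) < e"
      using X \<open>e > 0\<close> unfolding Cauchy_iff by blast
    have "(\<Sum>k\<in>F. exp (freq_l1 k) * \<bar>c k - coeff (X n) k\<bar>) \<le> e" if "n \<ge> N" "finite F" for n F
    proof (rule tendsto_upperbound)
      show "(\<lambda>m. \<Sum>k\<in>F. exp (freq_l1 k) * \<bar>coeff (X m) k - coeff (X n) k\<bar>)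
          \<longlonglongrightarrow> (\<Sum>k\<in>F. exp (freq_l1 k) * \<bar>c k - coeff (X n) k\<bar>)"
        by (intro tendsto_intros c)
      have "(\<Sum>k\<in>F. exp (freq_l1 k) * \<bar>coeff (X m) k - coeff (X n) k\<bar>) \<le> e" if "m \<ge> N" for m
        using sum_weighted_coeff_le[OF \<open>finite F\<close>, of "X m - X n"] N[OF that \<open>n \<ge> N\<close>] by simp
      then show "\<forall>\<^sub>F m in sequentially. (\<Sum>k\<in>F. exp (freq_l1 k) * \<bar>coeff (X m) k - coeff (X n) k\<bar>) \<le> e"
        by (auto simp: eventually_sequentially)
    qed simp
    then show ?thesis by blast
  qed
  have sum_diff: "(\<lambda>k. exp (freq_l1 k) * \<bar>c k - coeff (X n) k\<bar>) summable_on UNIV"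
    if "\<And>F. finite F \<Longrightarrow> (\<Sum>k\<in>F. exp (freq_l1 k) * \<bar>c k - coeff (X n) k\<bar>) \<le> e" for n e
    using that by (intro nonneg_bdd_above_summable_on) (auto simp: bdd_above_def)
  obtain N where "\<And>F. finite F \<Longrightarrow> (\<Sum>k\<in>F. exp (freq_l1 k) * \<bar>c k - coeff (X N) k\<bar>) \<le> 1"
    using bnd[of 1] by auto
  from weighted_summable_add[OF sum_diff[OF this] weighted_coeff_summable[of "X N"]]
  have "(\<lambda>k. exp (freq_l1 k) * \<bar>c k\<bar>) summable_on UNIV"
    by simp
  moreover have "c (- k) = c k" for k
    using LIMSEQ_unique[OF c[of k], of "c (- k)"] c[of "- k"] by simp
  ultimately have L: "coeff (Abs_cos_alg c) = c"
    by (intro Abs_cos_alg_inverse) blast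
  have "X \<longlonglongrightarrow> Abs_cos_alg c"
    unfolding LIMSEQ_iff
  proof (intro allI impI)
    fix e :: real assume "e > 0"
    then obtain N where N: "\<And>n F. n \<ge> N \<Longrightarrow> finite F \<Longrightarrow> (\<Sum>k\<in>F. exp (freq_l1 k) * \<bar>c k - coeff (X n) k\<bar>) \<le> e / 2"
      using bnd[of "e / 2"] by auto
    have "norm (X n - Abs_cos_alg c) < e" if "n \<ge> N" for n
    proof -
      have "norm (Abs_cos_alg c - X n) \<le> e / 2"
        unfolding norm_cos_alg_def using N[OF that]
        by (intro infsum_le_finite_sums weighted_coeff_summable) (auto simp: L)
      then show ?thesis
        using \<open>e > 0\<close> by (simp add: norm_minus_commute)
    qed
    then show "\<exists>N. \<forall>n\<ge>N. norm (X n - Abs_cos_alg c) < e" by blast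
  qed
  then show "convergent X"
    by (rule convergentI)
qed

section \<open>Elements as functions, convolution as pointwise product\<close>

definition eval :: "cos_alg \<Rightarrow> real \<times> real \<Rightarrow> real" where
  "eval a = trig_series (\<lambda>k. of_real (coeff a k))"

lemma exp_decay_coeff: "exp_decay (\<lambda>k. of_real (coeff a k))"
  unfolding exp_decay_def by (rule exI[of _ 1]) (use weighted_coeff_summable[of a] in simp)

lemma fourier_coeff_eval: "fourier_coeff (eval a) k = of_real (coeff a k)"
  unfolding eval_def by (subst fourier_coeff_trig_series) (auto intro: coeff_abs_summable)

lemma eval_inject: "eval a = eval b \<longleftrightarrow> a = b"
  using fourier_coeff_eval by (metis cos_alg_eqI of_real_eq_iff)

text \<open>Replacing k by - k conjugates every term, because the coefficients are real and even.
  Hence the complex sum is already real.\<close>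

lemma eval_has_sum: "((\<lambda>k. of_real (coeff a k) * cis (phase k p)) has_sum complex_of_real (eval a p)) UNIV"
proof -
  have "(\<lambda>k. of_real (coeff a k) * cis (phase k p)) summable_on UNIV"
    by (rule Infinite_Sum.abs_summable_summable) (use coeff_abs_summable in \<open>simp add: norm_mult\<close>)
  then obtain S where S: "((\<lambda>k. of_real (coeff a k) * cis (phase k p)) has_sum S) UNIV"
    by (auto simp: summable_on_def)
  have "bij_betw uminus (UNIV :: (int \<times> int) set) UNIV"
    by (rule bij_betwI[of _ _ _ uminus]) auto
  from has_sum_reindex_bij_betw[OF this, THEN iffD2, OF S]
  have "((\<lambda>k. cnj (of_real (coeff a k) * cis (phase k p))) has_sum S) UNIV"
    by (simp add: cis_cnj)
  moreover have "((\<lambda>k. cnj (of_real (coeff a k) * cis (phase k p))) has_sum cnj S) UNIV"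
    using S by (subst has_sum_cnj_iff)
  ultimately have "cnj S = S"
    by (metis has_sum_unique)
  moreover have "Re S = eval a p"
    using has_sum_Re[OF S] unfolding eval_def trig_series_def by (metis infsumI)
  ultimately have "S = complex_of_real (eval a p)"
    by (simp add: complex_eq_iff)
  with S show ?thesis by simp
qed

text \<open>The substitution k = m + n, which sorts the terms of a product of two series by total
  frequency.\<close>

lemma bij_betw_shear: "bij_betw (\<lambda>(k, m). (m, k - m)) (UNIV \<times> UNIV) (UNIV \<times> (UNIV :: 'a :: ab_group_add set))"
  by (rule bij_betwI[of _ _ _ "\<lambda>(m, n). (m + n, m)"]) auto

lemma convolution_weighted_has_sum:
  "((\<lambda>(k, m). (exp (freq_l1 m) * \<bar>coeff a m\<bar>) * (exp (freq_l1 (k - m)) * \<bar>coeff b (k - m)\<bar>))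
     has_sum norm a * norm b) (UNIV \<times> UNIV)"
proof -
  have "((\<lambda>(m, n). (exp (freq_l1 m) * \<bar>coeff a m\<bar>) * (exp (freq_l1 n) * \<bar>coeff b n\<bar>)) has_sum norm a * norm b) (UNIV \<times> UNIV)"
    unfolding norm_cos_alg_def
    by (intro has_sum_times has_sum_infsum) (simp_all add: weighted_coeff_summable abs_mult)
  from has_sum_reindex_bij_betw[OF bij_betw_shear, THEN iffD2, OF this] show ?thesis
    by (simp add: case_prod_unfold)
qed

definition convolution :: "cos_alg \<Rightarrow> cos_alg \<Rightarrow> int \<times> int \<Rightarrow> real" where
  "convolution a b k = (\<Sum>\<^sub>\<infinity>m. coeff a m * coeff b (k - m))"

text \<open>The weight is submultiplicative, by the triangle inequality for \<open>freq_l1\<close>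
  at k = m + (k - m). So everything is dominated by the product family, whose sum is
  \<open>norm a * norm b\<close>.\<close>

lemma convolution_weighted:
  shows "(\<lambda>m. coeff a m * coeff b (k - m)) summable_on UNIV"
    and "(\<lambda>k. exp (freq_l1 k) * \<bar>convolution a b k\<bar>) summable_on UNIV"
    and "(\<Sum>\<^sub>\<infinity>k. exp (freq_l1 k) * \<bar>convolution a b k\<bar>) \<le> norm a * norm b"
proof -
  let ?f = "\<lambda>k m. (exp (freq_l1 m) * \<bar>coeff a m\<bar>) * (exp (freq_l1 (k - m)) * \<bar>coeff b (k - m)\<bar>)"
  have sf: "(\<lambda>m. ?f k m) summable_on UNIV" for k
    using has_sum_imp_summable[OF convolution_weighted_has_sum] by (rule summable_on_SigmaD1) simp
  have fs: "((\<lambda>k. \<Sum>\<^sub>\<infinity>m. ?f k m) has_sum norm a * norm b) UNIV"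
    using convolution_weighted_has_sum by (rule has_sum_SigmaD) (use sf in auto)
  have le: "exp (freq_l1 k) * \<bar>coeff a m * coeff b (k - m)\<bar> \<le> ?f k m" for k m
  proof -
    have "exp (freq_l1 k) \<le> exp (freq_l1 m) * exp (freq_l1 (k - m))"
      using freq_l1_add[of m "k - m"] by (simp flip: exp_add)
    then have "exp (freq_l1 k) * (\<bar>coeff a m\<bar> * \<bar>coeff b (k - m)\<bar>) \<le>
        exp (freq_l1 m) * exp (freq_l1 (k - m)) * (\<bar>coeff a m\<bar> * \<bar>coeff b (k - m)\<bar>)"
      by (rule mult_right_mono) simp
    then show ?thesis by (simp add: abs_mult mult_ac)
  qed
  have sw: "(\<lambda>m. exp (freq_l1 k) * \<bar>coeff a m * coeff b (k - m)\<bar>) summable_on UNIV" for k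
    by (rule summable_on_comparison_test[OF sf le]) auto
  have sa: "(\<lambda>m. norm (coeff a m * coeff b (k - m))) summable_on UNIV" for k
    by (rule summable_on_comparison_test[OF sw[of k]]) (auto simp: abs_le_weighted)
  then show "(\<lambda>m. coeff a m * coeff b (k - m)) summable_on UNIV"
    by (rule Infinite_Sum.abs_summable_summable)
  have le': "exp (freq_l1 k) * \<bar>convolution a b k\<bar> \<le> (\<Sum>\<^sub>\<infinity>m. ?f k m)" for k
  proof -
    have "exp (freq_l1 k) * \<bar>convolution a b k\<bar> \<le> exp (freq_l1 k) * (\<Sum>\<^sub>\<infinity>m. \<bar>coeff a m * coeff b (k - m)\<bar>)"
      using norm_infsum_bound[OF sa[of k]] by (simp add: convolution_def)
    also have "\<dots> = (\<Sum>\<^sub>\<infinity>m. exp (freq_l1 k) * \<bar>coeff a m * coeff b (k - m)\<bar>)"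
      by (simp add: infsum_cmult_right')
    also have "\<dots> \<le> (\<Sum>\<^sub>\<infinity>m. ?f k m)"
      by (intro infsum_mono sw sf le)
    finally show ?thesis .
  qed
  show s: "(\<lambda>k. exp (freq_l1 k) * \<bar>convolution a b k\<bar>) summable_on UNIV"
    by (rule summable_on_comparison_test[OF has_sum_imp_summable[OF fs] le']) auto
  show "(\<Sum>\<^sub>\<infinity>k. exp (freq_l1 k) * \<bar>convolution a b k\<bar>) \<le> norm a * norm b"
    unfolding infsumI[OF fs, symmetric] by (intro infsum_mono s le' has_sum_imp_summable[OF fs])
qed

lemma convolution_minus: "convolution a b (- k) = convolution a b k"
proof -
  have "bij_betw uminus (UNIV :: (int \<times> int) set) UNIV"
    by (rule bij_betwI[of _ _ _ uminus]) auto
  from infsum_reindex_bij_betw[OF this, of "\<lambda>m. coeff a m * coeff b (- k - m)"]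
  have "convolution a b (- k) = (\<Sum>\<^sub>\<infinity>m. coeff a m * coeff b (- k - (- m)))"
    by (simp add: convolution_def)
  also have "\<dots> = convolution a b k"
    unfolding convolution_def
  proof (rule infsum_cong)
    fix m :: "int \<times> int"
    have "- k - (- m) = - (k - m)" by simp
    then show "coeff a m * coeff b (- k - (- m)) = coeff a m * coeff b (k - m)"
      by (simp only: coeff_minus_arg)
  qed
  finally show ?thesis .
qed

lemma convolution_eval:
  "((\<lambda>k. of_real (convolution a b k) * cis (phase k p)) has_sum complex_of_real (eval a p * eval b p)) UNIV"
proof -
  have "((\<lambda>(m, n). (of_real (coeff a m) * cis (phase m p)) * (of_real (coeff b n) * cis (phase n p)))
      has_sum complex_of_real (eval a p) * complex_of_real (eval b p)) (UNIV \<times> UNIV)"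
    by (intro has_sum_times eval_has_sum) (simp_all add: norm_mult coeff_abs_summable)
  from has_sum_reindex_bij_betw[OF bij_betw_shear, THEN iffD2, OF this]
  have *: "((\<lambda>(k, m). (of_real (coeff a m) * cis (phase m p)) * (of_real (coeff b (k - m)) * cis (phase (k - m) p)))
      has_sum complex_of_real (eval a p * eval b p)) (UNIV \<times> UNIV)"
    by (simp add: case_prod_unfold)
  have "((\<lambda>m. (of_real (coeff a m) * cis (phase m p)) * (of_real (coeff b (k - m)) * cis (phase (k - m) p)))
      has_sum of_real (convolution a b k) * cis (phase k p)) UNIV" for k
  proof -
    have "((\<lambda>m. of_real (coeff a m * coeff b (k - m)) * cis (phase k p)) has_sum
        of_real (convolution a b k) * cis (phase k p)) UNIV"
      unfolding convolution_def
      by (intro has_sum_cmult_left has_sum_of_real has_sum_infsum convolution_weighted)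
    moreover have "of_real (coeff a m * coeff b (k - m)) * cis (phase k p) =
        (of_real (coeff a m) * cis (phase m p)) * (of_real (coeff b (k - m)) * cis (phase (k - m) p))" for m
    proof -
      have "cis (phase k p) = cis (phase m p) * cis (phase (k - m) p)"
        using phase_add_left[of m "k - m" p] by (simp add: cis_mult)
      then show ?thesis by (simp only: of_real_mult mult_ac)
    qed
    ultimately show ?thesis by (simp only:)
  qed
  with * show ?thesis
    by (intro has_sum_SigmaD[OF *]) simp
qed

instantiation cos_alg :: "{times, one}"
begin
lift_definition times_cos_alg :: "cos_alg \<Rightarrow> cos_alg \<Rightarrow> cos_alg" is convolution
  using convolution_weighted(2) convolution_minus by blast
lift_definition one_cos_alg :: cos_alg is "\<lambda>k. if k = 0 then 1 else 0"
proof (intro conjI allI weighted_summable_finite)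
  show "finite {k :: int \<times> int. (if k = 0 then 1 else 0 :: real) \<noteq> 0}"
    by (rule finite_subset[of _ "{0}"]) (simp_all add: subset_iff del: split_paired_All)
qed simp
instance ..
end

lemma coeff_times: "coeff (a * b) k = (\<Sum>\<^sub>\<infinity>m. coeff a m * coeff b (k - m))"
  by (simp add: times_cos_alg.rep_eq convolution_def)

lemma coeff_one: "coeff 1 k = (if k = 0 then 1 else 0)"
  by (simp add: one_cos_alg.rep_eq)

lemma evalI: "((\<lambda>k. of_real (coeff a k) * cis (phase k p)) has_sum of_real x) UNIV \<Longrightarrow> eval a p = x"
  using has_sum_unique[OF eval_has_sum] of_real_eq_iff by blast

lemma eval_times [simp]: "eval (a * b) p = eval a p * eval b p"
  by (rule evalI) (simp only: times_cos_alg.rep_eq convolution_eval)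

lemma eval_one [simp]: "eval 1 p = 1"
proof (rule evalI)
  show "((\<lambda>k. of_real (coeff 1 k) * cis (phase k p)) has_sum complex_of_real 1) UNIV"
    by (rule has_sum_finite_neutralI[of "{0}"]) (auto simp: coeff_one phase_def)
qed

lemma eval_add [simp]: "eval (a + b) p = eval a p + eval b p"
  by (rule evalI) (use has_sum_add[OF eval_has_sum eval_has_sum, of a p b p] in \<open>simp add: distrib_right\<close>)

lemma eval_scaleR [simp]: "eval (r *\<^sub>R a) p = r * eval a p"
  by (rule evalI) (use has_sum_cmult_right[OF eval_has_sum, of "of_real r" a p] in \<open>simp add: mult.assoc\<close>)

lemma eval_minus [simp]: "eval (- a) p = - eval a p"
  using eval_scaleR[of "- 1" a p] by simp

lemma eval_zero [simp]: "eval 0 p = 0"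
  using eval_scaleR[of 0 0 p] by simp

lemma eval_diff [simp]: "eval (a - b) p = eval a p - eval b p"
  using eval_add[of a "- b" p] by simp

text \<open>With this, the ring axioms reduce to pointwise identities of real functions.\<close>

lemma eval_eqI: "(\<And>p. eval a p = eval b p) \<Longrightarrow> a = b"
  by (metis eval_inject ext)

instance cos_alg :: comm_ring_1
proof
  have "coeff 0 0 \<noteq> coeff 1 0"
    by (simp add: coeff_one)
  then show "(0 :: cos_alg) \<noteq> 1" by metis
qed (rule eval_eqI; simp add: algebra_simps)+

lemma norm_mult_cos_alg: "norm (a * b) \<le> norm a * norm (b :: cos_alg)"
  using convolution_weighted(3)[of a b] by (simp add: norm_cos_alg_def times_cos_alg.rep_eq)

lemma norm_one_cos_alg: "norm (1 :: cos_alg) = 1"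
proof -
  have "((\<lambda>k. exp (freq_l1 k) * \<bar>coeff 1 k\<bar>) has_sum 1) UNIV"
    by (rule has_sum_finite_neutralI[of "{0}"]) (auto simp: coeff_one freq_l1_def)
  then show ?thesis
    unfolding norm_cos_alg_def by (rule infsumI)
qed

instance cos_alg :: real_normed_algebra_1
proof
  fix r :: real and a b :: cos_alg
  show "r *\<^sub>R a * b = r *\<^sub>R (a * b)"
    by (rule eval_eqI) simp
  show "a * r *\<^sub>R b = r *\<^sub>R (a * b)"
    by (rule eval_eqI) simp
qed (rule norm_mult_cos_alg norm_one_cos_alg)+

section \<open>Perturbation calculus\<close>

text \<open>\<open>approx R n f c\<close> says that \<open>f \<delta>\<close> is \<open>c + O(\<delta>\<^sup>n)\<close> on the ball of radius \<open>R\<close>, in the sup norm and in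
  the Lipschitz seminorm. At order 0 the value \<open>c\<close> is irrelevant.\<close>

definition approx_with ::
  "real \<Rightarrow> real \<Rightarrow> nat \<Rightarrow> (real \<Rightarrow> 'z :: real_normed_vector \<Rightarrow> 'a :: real_normed_vector) \<Rightarrow> 'a \<Rightarrow> bool" where
  "approx_with C R n f c \<longleftrightarrow> 0 \<le> C \<and>
     (\<forall>\<delta> x. 0 < \<delta> \<longrightarrow> \<delta> \<le> 1 \<longrightarrow> norm x \<le> R \<longrightarrow> norm (f \<delta> x - c) \<le> C * \<delta> ^ n) \<and>
     (\<forall>\<delta> x y. 0 < \<delta> \<longrightarrow> \<delta> \<le> 1 \<longrightarrow> norm x \<le> R \<longrightarrow> norm y \<le> R \<longrightarrow>
        norm (f \<delta> x - f \<delta> y) \<le> C * \<delta> ^ n * norm (x - y))"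

definition approx ::
  "real \<Rightarrow> nat \<Rightarrow> (real \<Rightarrow> 'z :: real_normed_vector \<Rightarrow> 'a :: real_normed_vector) \<Rightarrow> 'a \<Rightarrow> bool" where
  "approx R n f c \<longleftrightarrow> (\<exists>C. approx_with C R n f c)"

lemma approx_withD:
  assumes "approx_with C R n f c"
  shows "0 \<le> C"
    and "0 < \<delta> \<Longrightarrow> \<delta> \<le> 1 \<Longrightarrow> norm x \<le> R \<Longrightarrow> norm (f \<delta> x - c) \<le> C * \<delta> ^ n"
    and "0 < \<delta> \<Longrightarrow> \<delta> \<le> 1 \<Longrightarrow> norm x \<le> R \<Longrightarrow> norm y \<le> R \<Longrightarrow>
      norm (f \<delta> x - f \<delta> y) \<le> C * \<delta> ^ n * norm (x - y)"
  using assms unfolding approx_with_def by auto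

lemma approxI:
  assumes "0 \<le> C"
    and "\<And>\<delta> x. 0 < \<delta> \<Longrightarrow> \<delta> \<le> 1 \<Longrightarrow> norm x \<le> R \<Longrightarrow> norm (f \<delta> x - c) \<le> C * \<delta> ^ n"
    and "\<And>\<delta> x y. 0 < \<delta> \<Longrightarrow> \<delta> \<le> 1 \<Longrightarrow> norm x \<le> R \<Longrightarrow> norm y \<le> R \<Longrightarrow>
      norm (f \<delta> x - f \<delta> y) \<le> C * \<delta> ^ n * norm (x - y)"
  shows "approx R n f c"
  using assms unfolding approx_def approx_with_def by blast

lemma approx_cong:
  assumes "approx R n f c" "\<And>\<delta> x. 0 < \<delta> \<Longrightarrow> f \<delta> x = g \<delta> x"
  shows "approx R n g c"
  using assms unfolding approx_def approx_with_def by simp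

lemma approx_const: "approx R n (\<lambda>_ _. c) c"
  by (rule approxI[of 0]) auto

lemma approx_fixed:
  assumes "bounded_linear L"
  shows "approx R 0 (\<lambda>_. L) 0"
proof -
  obtain K where K: "K \<ge> 0" "\<And>x. norm (L x) \<le> norm x * K"
    using bounded_linear.nonneg_bounded[OF assms] by blast
  show ?thesis
  proof (rule approxI[of "K * (\<bar>R\<bar> + 1)"])
    fix x y :: 'a
    show "norm (L x - 0) \<le> K * (\<bar>R\<bar> + 1) * \<delta> ^ 0" if "norm x \<le> R" for \<delta> :: real
    proof -
      have "norm x \<le> \<bar>R\<bar> + 1" using that by linarith
      from mult_left_mono[OF this K(1)] K(2)[of x] show ?thesis
        by (simp add: mult.commute)
    qed
    have "norm (L x - L y) \<le> K * norm (x - y)"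
      using K(2)[of "x - y"] by (simp add: linear_diff[OF bounded_linear.linear[OF assms]] mult.commute)
    also have "\<dots> \<le> K * (\<bar>R\<bar> + 1) * norm (x - y)"
      using K(1) by (intro mult_right_mono) (auto simp: mult_le_cancel_left1)
    finally show "norm (L x - L y) \<le> K * (\<bar>R\<bar> + 1) * \<delta> ^ 0 * norm (x - y)" for \<delta> :: real
      by simp
  qed (use K in auto)
qed

lemma approx_mono:
  assumes "approx R m f c" "n \<le> m"
  shows "approx R n f c"
proof -
  obtain C where C: "approx_with C R m f c"
    using assms(1) unfolding approx_def ..
  have "C * \<delta> ^ m \<le> C * \<delta> ^ n" if "0 < \<delta>" "\<delta> \<le> 1" for \<delta> :: real
    using that \<open>n \<le> m\<close> approx_withD(1)[OF C] by (intro mult_left_mono power_decreasing) auto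
  then show ?thesis
    by (intro approxI[OF approx_withD(1)[OF C]])
      (meson approx_withD(2,3)[OF C] order_trans mult_right_mono norm_ge_zero)+
qed

lemma approx_order_0:
  assumes "approx R 0 f a"
  shows "approx R 0 f b"
proof -
  obtain C where C: "approx_with C R 0 f a"
    using assms(1) unfolding approx_def ..
  show ?thesis
  proof (rule approxI[of "C + norm (a - b)"])
    fix \<delta> :: real and x y :: 'a
    assume *: "0 < \<delta>" "\<delta> \<le> 1" "norm x \<le> R"
    show "norm (f \<delta> x - b) \<le> (C + norm (a - b)) * \<delta> ^ 0"
      using norm_triangle_ineq[of "f \<delta> x - a" "a - b"] approx_withD(2)[OF C *] by simp
    assume "norm y \<le> R"
    from approx_withD(3)[OF C * this]
    show "norm (f \<delta> x - f \<delta> y) \<le> (C + norm (a - b)) * \<delta> ^ 0 * norm (x - y)"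
      by (simp add: distrib_right add_increasing2)
  qed (use approx_withD(1)[OF C] in auto)
qed

lemma approx_add:
  assumes "approx R n f a" "approx R n g b"
  shows "approx R n (\<lambda>\<delta> x. f \<delta> x + g \<delta> x) (a + b)"
proof -
  obtain C D where C: "approx_with C R n f a" and D: "approx_with D R n g b"
    using assms unfolding approx_def by blast
  show ?thesis
  proof (rule approxI[of "C + D"])
    fix \<delta> :: real and x y :: 'a
    assume *: "0 < \<delta>" "\<delta> \<le> 1" "norm x \<le> R"
    show "norm (f \<delta> x + g \<delta> x - (a + b)) \<le> (C + D) * \<delta> ^ n"
      unfolding add_diff_add distrib_right
      by (intro norm_triangle_mono approx_withD(2)[OF C *] approx_withD(2)[OF D *])
    assume **: "norm y \<le> R"
    show "norm (f \<delta> x + g \<delta> x - (f \<delta> y + g \<delta> y)) \<le> (C + D) * \<delta> ^ n * norm (x - y)"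
      unfolding add_diff_add distrib_right
      by (intro norm_triangle_mono approx_withD(3)[OF C * **] approx_withD(3)[OF D * **])
  qed (use approx_withD(1)[OF C] approx_withD(1)[OF D] in auto)
qed

lemma approx_bounded_linear:
  assumes "bounded_linear L" "approx R n f a"
  shows "approx R n (\<lambda>\<delta> x. L (f \<delta> x)) (L a)"
proof -
  obtain C where C: "approx_with C R n f a"
    using assms unfolding approx_def by blast
  obtain K where K: "K \<ge> 0" "\<And>x. norm (L x) \<le> norm x * K"
    using bounded_linear.nonneg_bounded[OF assms(1)] by blast
  have L: "norm (L u - L v) \<le> K * B" if "norm (u - v) \<le> B" for u v B
    using K(2)[of "u - v"] mult_right_mono[OF that K(1)]
    by (simp add: linear_diff[OF bounded_linear.linear[OF assms(1)]] mult.commute[of K])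
  show ?thesis
    by (rule approxI[of "K * C"]) (use approx_withD[OF C] K L in \<open>auto simp: mult.assoc\<close>)
qed

lemma approx_Pair:
  assumes "approx R n f a" "approx R n g b"
  shows "approx R n (\<lambda>\<delta> x. (f \<delta> x, g \<delta> x)) (a, b)"
proof -
  have "bounded_linear (\<lambda>u :: 'b. (u, 0 :: 'c))" "bounded_linear (\<lambda>v :: 'c. (0 :: 'b, v))"
    by (intro bounded_linear_Pair bounded_linear_ident bounded_linear_zero)+
  from approx_add[OF approx_bounded_linear[OF this(1) assms(1)] approx_bounded_linear[OF this(2) assms(2)]]
  show ?thesis by simp
qed

lemma approx_prod:
  assumes P: "bounded_bilinear P" and "approx R n f a" "approx R n g b"
  shows "approx R n (\<lambda>\<delta> x. P (f \<delta> x) (g \<delta> x)) (P a b)"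
proof -
  interpret P: bounded_bilinear P by fact
  obtain C D where C: "approx_with C R n f a" and D: "approx_with D R n g b"
    using assms unfolding approx_def by blast
  note C0 = approx_withD(1)[OF C] and D0 = approx_withD(1)[OF D]
  obtain K where K: "K \<ge> 0" "\<And>a b. norm (P a b) \<le> norm a * norm b * K"
    using P.nonneg_bounded by blast
  define A where "A = C + norm a"
  define B where "B = D + norm b"
  have AB: "A \<ge> 0" "B \<ge> 0" using C0 D0 by (auto simp: A_def B_def)
  \<comment> \<open>One estimate serves both halves of \<open>approx\<close>: comparison with the
    limit values uses e = \<delta>^n, comparison of two points uses e = \<delta>^n norm (x -
    y).\<close>
  have step: "norm (P u v - P u' v') \<le> (A * K * D + B * K * C) * e"
    if "norm u \<le> A" "norm v' \<le> B" "norm (u - u') \<le> C * e" "norm (v - v') \<le> D * e" "e \<ge> 0" for u u' v v' e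
  proof -
    have "P u v - P u' v' = P u (v - v') + P (u - u') v'"
      by (simp add: P.diff_left P.diff_right)
    also have "norm \<dots> \<le> norm u * norm (v - v') * K + norm (u - u') * norm v' * K"
      using K(2) by (intro norm_triangle_mono)
    also have "\<dots> \<le> A * (D * e) * K + C * e * B * K"
      using that AB K(1) C0 D0 by (intro add_mono mult_mono mult_right_mono) auto
    finally show ?thesis by (simp add: algebra_simps)
  qed
  have bnd: "norm (f \<delta> x) \<le> A \<and> norm (g \<delta> x) \<le> B" if "0 < \<delta>" "\<delta> \<le> 1" "norm x \<le> R" for \<delta> x
  proof -
    have "\<delta> ^ n \<le> 1" using that by (intro power_le_one) auto
    then have "C * \<delta> ^ n \<le> C" "D * \<delta> ^ n \<le> D"
      using C0 D0 by (auto simp: mult_left_le)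
    then show ?thesis
      using approx_withD(2)[OF C that] approx_withD(2)[OF D that]
        norm_triangle_sub[of "f \<delta> x" a] norm_triangle_sub[of "g \<delta> x" b]
      by (auto simp: A_def B_def)
  qed
  show ?thesis
  proof (rule approxI[of "A * K * D + B * K * C"])
    fix \<delta> :: real and x y :: 'd
    assume *: "0 < \<delta>" "\<delta> \<le> 1" "norm x \<le> R"
    show "norm (P (f \<delta> x) (g \<delta> x) - P a b) \<le> (A * K * D + B * K * C) * \<delta> ^ n"
      using bnd[OF *] * D0
      by (intro step approx_withD(2)[OF C *] approx_withD(2)[OF D *]) (auto simp: B_def)
    assume **: "norm y \<le> R"
    have "norm (P (f \<delta> x) (g \<delta> x) - P (f \<delta> y) (g \<delta> y)) \<le> (A * K * D + B * K * C) * (\<delta> ^ n * norm (x - y))"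
      using bnd[OF *] bnd[OF *(1,2) **] approx_withD(3)[OF C * **] approx_withD(3)[OF D * **] *
      by (intro step) (auto simp: mult.assoc)
    then show "norm (P (f \<delta> x) (g \<delta> x) - P (f \<delta> y) (g \<delta> y)) \<le> (A * K * D + B * K * C) * \<delta> ^ n * norm (x - y)"
      by (simp add: mult.assoc)
  qed (use AB C0 D0 K(1) in auto)
qed

lemmas approx_mult = approx_prod[OF bounded_bilinear_mult]
lemmas approx_scaleR = approx_prod[OF bounded_bilinear_scaleR]

lemma approx_minus: "approx R n f a \<Longrightarrow> approx R n (\<lambda>\<delta> x. - f \<delta> x) (- a)"
  by (rule approx_bounded_linear[OF bounded_linear_minus[OF bounded_linear_ident]])

lemma approx_diff:
  "approx R n f a \<Longrightarrow> approx R n g b \<Longrightarrow> approx R n (\<lambda>\<delta> x. f \<delta> x - g \<delta> x) (a - b)"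
  using approx_add[of R n f a "\<lambda>\<delta> x. - g \<delta> x" "- b"] approx_minus[of R n g b] by simp

lemma approx_power:
  fixes f :: "real \<Rightarrow> 'z :: real_normed_vector \<Rightarrow> 'a :: real_normed_algebra_1"
  assumes "approx R n f a"
  shows "approx R n (\<lambda>\<delta> x. f \<delta> x ^ m) (a ^ m)"
  by (induction m) (auto intro!: approx_const approx_mult assms)

lemma approx_delta_mult:
  assumes "approx R n f 0"
  shows "approx R (n + m) (\<lambda>\<delta> x. \<delta> ^ m *\<^sub>R f \<delta> x) 0"
proof -
  obtain C where C: "approx_with C R n f 0"
    using assms unfolding approx_def ..
  show ?thesis
  proof (rule approxI[OF approx_withD(1)[OF C]])
    fix \<delta> :: real and x y :: 'a
    assume *: "0 < \<delta>" "\<delta> \<le> 1" "norm x \<le> R"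
    show "norm (\<delta> ^ m *\<^sub>R f \<delta> x - 0) \<le> C * \<delta> ^ (n + m)"
      using mult_left_mono[OF approx_withD(2)[OF C *], of "\<delta> ^ m"] * by (simp add: power_add mult_ac)
    assume "norm y \<le> R"
    from mult_left_mono[OF approx_withD(3)[OF C * this], of "\<delta> ^ m"] *
    show "norm (\<delta> ^ m *\<^sub>R f \<delta> x - \<delta> ^ m *\<^sub>R f \<delta> y) \<le> C * \<delta> ^ (n + m) * norm (x - y)"
      by (simp add: power_add mult_ac flip: scaleR_diff_right)
  qed
qed

lemma approx_delta_divide:
  assumes "approx R (n + m) f 0"
  shows "approx R n (\<lambda>\<delta> x. (1 / \<delta> ^ m) *\<^sub>R f \<delta> x) 0"
proof -
  obtain C where C: "approx_with C R (n + m) f 0"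
    using assms unfolding approx_def ..
  show ?thesis
  proof (rule approxI[OF approx_withD(1)[OF C]])
    fix \<delta> :: real and x y :: 'a
    assume *: "0 < \<delta>" "\<delta> \<le> 1" "norm x \<le> R"
    show "norm ((1 / \<delta> ^ m) *\<^sub>R f \<delta> x - 0) \<le> C * \<delta> ^ n"
      using approx_withD(2)[OF C *] * by (simp add: power_add field_simps)
    assume "norm y \<le> R"
    from mult_left_mono[OF approx_withD(3)[OF C * this], of "1 / \<delta> ^ m"] *
    show "norm ((1 / \<delta> ^ m) *\<^sub>R f \<delta> x - (1 / \<delta> ^ m) *\<^sub>R f \<delta> y) \<le> C * \<delta> ^ n * norm (x - y)"
      by (simp add: power_add mult_ac flip: scaleR_diff_right)
  qed
qed

text \<open>Since \<open>g\<close> is merely bounded and Lipschitz, \<open>approx_prod\<close> is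
  applied at order 0 to f / \<delta>^n and \<open>g\<close>, and the factor \<delta>^n is restored
  afterwards.\<close>

lemma approx_prod_zero:
  assumes P: "bounded_bilinear P" and "approx R n f 0" "approx R 0 g b"
  shows "approx R n (\<lambda>\<delta> x. P (f \<delta> x) (g \<delta> x)) 0"
proof -
  interpret P: bounded_bilinear P by fact
  have "approx R 0 (\<lambda>\<delta> x. (1 / \<delta> ^ n) *\<^sub>R f \<delta> x) 0"
    using assms(2) by (intro approx_delta_divide) simp
  from approx_delta_mult[OF approx_order_0[OF approx_prod[OF P this assms(3)], of 0], of n]
  have "approx R (0 + n) (\<lambda>\<delta> x. P (f \<delta> x) (g \<delta> x)) 0"
    by (rule approx_cong) (simp_all add: P.scaleR_left)
  then show ?thesis by simp
qed

lemmas approx_mult_zero = approx_prod_zero[OF bounded_bilinear_mult]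

text \<open>Order 1 says that \<open>T \<delta>\<close> is within C \<delta> of the constant
  \<open>z0\<close> and has Lipschitz constant C \<delta> on the ball, so for small \<delta> it is a
  contraction of that ball.\<close>

lemma approx_fixpoint:
  fixes T :: "real \<Rightarrow> 'z :: banach \<Rightarrow> 'z"
  assumes "approx R 1 T z0" "norm z0 < R"
  obtains \<delta>0 where "0 < \<delta>0" "\<delta>0 \<le> 1" "\<And>\<delta>. 0 < \<delta> \<Longrightarrow> \<delta> \<le> \<delta>0 \<Longrightarrow> \<exists>x. norm x \<le> R \<and> T \<delta> x = x"
proof -
  obtain C where C: "approx_with C R 1 T z0"
    using assms unfolding approx_def by blast
  note C0 = approx_withD(1)[OF C]
  \<comment> \<open>The two quotients keep the ball invariant and the contraction constant at most
    1/2; \<open>C + 1\<close> avoids division by zero.\<close>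
  define \<delta>0 where "\<delta>0 = min 1 (min ((R - norm z0) / (C + 1)) (1 / (2 * (C + 1))))"
  have *: "\<exists>x. norm x \<le> R \<and> T \<delta> x = x" if "0 < \<delta>" "\<delta> \<le> \<delta>0" for \<delta>
  proof -
    have "\<delta> \<le> 1" "\<delta> * (C + 1) \<le> R - norm z0" "\<delta> * (C + 1) \<le> 1 / 2"
      using that C0 by (auto simp: \<delta>0_def field_simps)
    then have \<delta>: "\<delta> \<le> 1" "C * \<delta> \<le> R - norm z0" "C * \<delta> \<le> 1 / 2"
      using that(1) by (auto simp: algebra_simps)
    have "\<exists>!x. x \<in> cball 0 R \<and> T \<delta> x = x"
    proof (rule Banach_fix[where c = "C * \<delta>"])
      show "complete (cball (0 :: 'z) R)"
        by (simp add: complete_eq_closed)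
      have "norm (0 :: 'z) \<le> R"
        using assms(2) norm_ge_zero[of z0] by (simp del: norm_ge_zero)
      then show "cball (0 :: 'z) R \<noteq> {}"
        by (auto simp: ball_eq_empty)
      show "0 \<le> C * \<delta>" "C * \<delta> < 1"
        using C0 that \<delta> by auto
      show "T \<delta> ` cball 0 R \<subseteq> cball 0 R"
      proof clarsimp
        fix x :: 'z assume "norm x \<le> R"
        with approx_withD(2)[OF C \<open>0 < \<delta>\<close> \<delta>(1)] have "norm (T \<delta> x - z0) \<le> C * \<delta>"
          by simp
        then show "norm (T \<delta> x) \<le> R"
          using \<delta>(2) norm_triangle_sub[of "T \<delta> x" z0] by linarith
      qed
      show "dist (T \<delta> x) (T \<delta> y) \<le> C * \<delta> * dist x y" if "x \<in> cball 0 R" "y \<in> cball 0 R" for x y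
        using approx_withD(3)[OF C \<open>0 < \<delta>\<close> \<delta>(1), of x y] that by (simp add: dist_norm)
    qed
    then show ?thesis by auto
  qed
  moreover have "0 < \<delta>0" "\<delta>0 \<le> 1"
    using assms(2) C0 by (auto simp: \<delta>0_def)
  ultimately show thesis using that by blast
qed

lemma norm_cos_alg_mono:
  assumes "\<And>k. \<bar>coeff a k\<bar> \<le> \<bar>coeff b k\<bar>"
  shows "norm a \<le> norm b"
  unfolding norm_cos_alg_def
  by (intro infsum_mono weighted_coeff_summable mult_left_mono) (auto simp: assms)

section \<open>Operators and harmonics\<close>

lift_definition x_mean :: "cos_alg \<Rightarrow> cos_alg" is "\<lambda>a k. if fst k = 0 then a k else 0"
proof (intro conjI allI)
  fix a :: "int \<times> int \<Rightarrow> real" and k :: "int \<times> int"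
  assume "(\<forall>k. a (- k) = a k) \<and> (\<lambda>k. exp (freq_l1 k) * \<bar>a k\<bar>) summable_on UNIV"
  then have a: "a (- k) = a k" and s: "(\<lambda>k. exp (freq_l1 k) * \<bar>a k\<bar>) summable_on UNIV"
    by blast+
  show "(if fst (- k) = 0 then a (- k) else 0) = (if fst k = 0 then a k else 0)"
    using a by simp
  show "(\<lambda>k. exp (freq_l1 k) * \<bar>if fst k = 0 then a k else 0\<bar>) summable_on UNIV"
    by (rule summable_on_comparison_test[OF s]) auto
qed

text \<open>The eigenvalues 1 - n of \<Delta> + 1 are integers, so the nonzero ones have modulus at
  least 1. This makes \<open>helmholtz_inv\<close> an operator of norm at most 1.\<close>

lemma abs_divide_one_minus_le: "\<bar>if n = 1 then 0 else r / of_int (1 - n)\<bar> \<le> \<bar>r :: real\<bar>" for n :: int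
proof (cases "n = 1")
  case False
  then have "\<bar>1 - n\<bar> \<ge> 1" by linarith
  then have "\<bar>real_of_int (1 - n)\<bar> \<ge> 1" by linarith
  from frac_le[OF abs_ge_zero order_refl zero_less_one this, of r] False show ?thesis
    by (simp add: abs_divide)
qed simp

text \<open>The inverse of \<open>\<Delta> + 1\<close>, extended by 0 to its kernel (the frequencies of length 1).\<close>

lift_definition helmholtz_inv :: "cos_alg \<Rightarrow> cos_alg" is
  "\<lambda>a k. if (fst k)\<^sup>2 + (snd k)\<^sup>2 = 1 then 0 else a k / of_int (1 - ((fst k)\<^sup>2 + (snd k)\<^sup>2))"
proof (intro conjI allI)
  fix a :: "int \<times> int \<Rightarrow> real" and k :: "int \<times> int"
  assume "(\<forall>k. a (- k) = a k) \<and> (\<lambda>k. exp (freq_l1 k) * \<bar>a k\<bar>) summable_on UNIV"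
  then have a: "a (- k) = a k" and s: "(\<lambda>k. exp (freq_l1 k) * \<bar>a k\<bar>) summable_on UNIV"
    by blast+
  show "(if (fst (- k))\<^sup>2 + (snd (- k))\<^sup>2 = 1 then 0 else a (- k) / of_int (1 - ((fst (- k))\<^sup>2 + (snd (- k))\<^sup>2))) =
      (if (fst k)\<^sup>2 + (snd k)\<^sup>2 = 1 then 0 else a k / of_int (1 - ((fst k)\<^sup>2 + (snd k)\<^sup>2)))"
    using a by simp
  show "(\<lambda>k. exp (freq_l1 k) * \<bar>if (fst k)\<^sup>2 + (snd k)\<^sup>2 = 1 then 0
      else a k / of_int (1 - ((fst k)\<^sup>2 + (snd k)\<^sup>2))\<bar>) summable_on UNIV"
    by (intro summable_on_comparison_test[OF s] mult_left_mono abs_divide_one_minus_le) auto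
qed

lemmas coeff_x_mean = x_mean.rep_eq
lemmas coeff_helmholtz_inv = helmholtz_inv.rep_eq

lemma abs_coeff_helmholtz_inv_le: "\<bar>coeff (helmholtz_inv a) k\<bar> \<le> \<bar>coeff a k\<bar>"
  unfolding coeff_helmholtz_inv by (rule abs_divide_one_minus_le)

lemma bounded_linear_x_mean: "bounded_linear x_mean"
proof (rule bounded_linear_intro[of _ 1])
  show "norm (x_mean a) \<le> norm a * 1" for a
    using norm_cos_alg_mono[of "x_mean a" a] by (simp add: coeff_x_mean)
qed (rule cos_alg_eqI; simp add: coeff_x_mean)+

lemma bounded_linear_helmholtz_inv: "bounded_linear helmholtz_inv"
proof (rule bounded_linear_intro[of _ 1])
  show "norm (helmholtz_inv a) \<le> norm a * 1" for a
    using norm_cos_alg_mono[OF abs_coeff_helmholtz_inv_le] by simp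
qed (rule cos_alg_eqI; simp add: coeff_helmholtz_inv add_divide_distrib)+

text \<open>If the first frequency of k is nonzero, so is that of m or of k - m, and every term of
  the convolution vanishes. The elements fixed by \<open>x_mean\<close> are the functions of y
  alone.\<close>

lemma x_mean_times:
  assumes "x_mean a = a" "x_mean b = b"
  shows "x_mean (a * b) = a * b"
proof (rule cos_alg_eqI)
  fix k :: "int \<times> int"
  have z: "coeff c m = 0" if "x_mean c = c" "fst m \<noteq> 0" for c m
    using that by (metis coeff_x_mean)
  have "coeff a m * coeff b (k - m) = 0" if "fst k \<noteq> 0" for m
    using z[OF assms(1), of m] z[OF assms(2), of "k - m"] that by (cases "fst m = 0") auto
  then have "coeff (a * b) k = 0" if "fst k \<noteq> 0"
    unfolding coeff_times using that by (intro infsum_0) blast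
  then show "coeff (x_mean (a * b)) k = coeff (a * b) k"
    by (simp add: coeff_x_mean)
qed

text \<open>A sum of two conditionals, so that for m = 0 the halves add up and the result is the
  constant 1.\<close>

lift_definition harmonic :: "int \<times> int \<Rightarrow> cos_alg" is
  "\<lambda>m k. (if k = m then 1 / 2 else 0) + (if k = - m then 1 / 2 else 0)"
proof (intro conjI allI weighted_summable_finite)
  fix m k :: "int \<times> int"
  show "(if - k = m then 1 / 2 else 0) + (if - k = - m then 1 / 2 else 0) =
      ((if k = m then 1 / 2 else 0) + (if k = - m then 1 / 2 else 0) :: real)"
    by (auto simp only: minus_equation_iff[of k m] neg_equal_iff_equal eq_commute[of k "- m"])
  show "finite {k. (if k = m then 1 / 2 else 0) + (if k = - m then 1 / 2 else 0) \<noteq> (0 :: real)}"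
    by (rule finite_subset[of _ "{m, - m}"]) (simp_all add: subset_iff del: split_paired_All)
qed

lemmas coeff_harmonic = harmonic.rep_eq

lemma eval_harmonic: "eval (harmonic m) p = cos (phase m p)"
proof -
  have "((\<lambda>k. (if k = m then cis (phase m p) / 2 else 0) + (if k = - m then cis (- phase m p) / 2 else 0))
      has_sum cis (phase m p) / 2 + cis (- phase m p) / 2) UNIV"
    by (intro has_sum_add has_sum_finite_neutralI[of "{m}"] has_sum_finite_neutralI[of "{- m}"]) auto
  moreover have "(if k = m then cis (phase m p) / 2 else 0) + (if k = - m then cis (- phase m p) / 2 else 0)
      = of_real (coeff (harmonic m) k) * cis (phase k p)" for k
    by (auto simp: coeff_harmonic distrib_right) (metis phase_minus_left)
  moreover have "cis (phase m p) / 2 + cis (- phase m p) / 2 = of_real (cos (phase m p))"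
    by (simp add: complex_eq_iff)
  ultimately show ?thesis
    by (intro evalI) simp
qed

lemma harmonic_times: "harmonic j * harmonic k = (1 / 2) *\<^sub>R (harmonic (j + k) + harmonic (j - k))"
proof (rule eval_eqI)
  fix p
  have "phase (j - k) p = phase j p - phase k p"
    using phase_add_left[of j "- k" p] by simp
  then show "eval (harmonic j * harmonic k) p = eval ((1 / 2) *\<^sub>R (harmonic (j + k) + harmonic (j - k))) p"
    by (simp add: eval_harmonic phase_add_left cos_add cos_diff)
qed

lemma harmonic_0: "harmonic 0 = 1"
  by (rule eval_eqI) (simp add: eval_harmonic phase_def)

abbreviation cos_x :: cos_alg where "cos_x \<equiv> harmonic (1, 0)"
abbreviation cos_y :: cos_alg where "cos_y \<equiv> harmonic (0, 1)"

lemma cos_y_power2: "cos_y ^ 2 = (1 / 2) *\<^sub>R (1 + harmonic (0, 2))"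
  by (simp add: power2_eq_square harmonic_times add.commute flip: harmonic_0 zero_prod_def)

lemma cos_y_power4: "cos_y ^ 4 = (3 / 8) *\<^sub>R 1 + (1 / 2) *\<^sub>R harmonic (0, 2) + (1 / 8) *\<^sub>R harmonic (0, 4)"
proof -
  have "cos_y ^ 4 = cos_y ^ 2 * cos_y ^ 2"
    by (simp flip: power_add)
  also have "\<dots> = (1 / 4) *\<^sub>R (1 + 2 *\<^sub>R harmonic (0, 2) + harmonic (0, 2) * harmonic (0, 2))"
    unfolding cos_y_power2 by (simp add: algebra_simps flip: scaleR_2)
  also have "harmonic (0, 2) * harmonic (0, 2) = (1 / 2) *\<^sub>R (harmonic (0, 4) + 1)"
    by (simp add: harmonic_times flip: harmonic_0 zero_prod_def)
  finally show ?thesis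
    by (simp add: algebra_simps flip: scaleR_add_left)
qed

lemma cos_y_power3: "cos_y ^ 3 = (3 / 4) *\<^sub>R cos_y + (1 / 4) *\<^sub>R harmonic (0, 3)"
proof -
  have "cos_y ^ 3 = cos_y ^ 2 * cos_y"
    by (simp add: power2_eq_square power3_eq_cube)
  also have "\<dots> = (1 / 2) *\<^sub>R (cos_y + harmonic (0, 2) * cos_y)"
    unfolding cos_y_power2 by (simp add: algebra_simps)
  also have "harmonic (0, 2) * cos_y = (1 / 2) *\<^sub>R (harmonic (0, 3) + cos_y)"
    by (simp add: harmonic_times)
  finally show ?thesis
    by (simp add: algebra_simps flip: scaleR_add_left)
qed

lemma cos_y_power5:
  "cos_y ^ 5 = (5 / 8) *\<^sub>R cos_y + (5 / 16) *\<^sub>R harmonic (0, 3) + (1 / 16) *\<^sub>R harmonic (0, 5)"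
proof -
  have "cos_y ^ 5 = cos_y ^ 4 * cos_y"
    by (simp flip: power_Suc2)
  also have "\<dots> = (3 / 8) *\<^sub>R cos_y + (1 / 2) *\<^sub>R (harmonic (0, 2) * cos_y) + (1 / 8) *\<^sub>R (harmonic (0, 4) * cos_y)"
    unfolding cos_y_power4 by (simp add: algebra_simps)
  also have "harmonic (0, 2) * cos_y = (1 / 2) *\<^sub>R (harmonic (0, 3) + cos_y)"
    by (simp add: harmonic_times)
  also have "harmonic (0, 4) * cos_y = (1 / 2) *\<^sub>R (harmonic (0, 5) + harmonic (0, 3))"
    by (simp add: harmonic_times)
  finally show ?thesis
    by (intro cos_alg_eqI) (simp add: field_simps)
qed

section \<open>The nonlinearity\<close>

text \<open>\<open>nonlin1\<close> and \<open>nonlin2\<close> span the odd cubics and are dual to the two solvability conditions: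
  for \<open>nonlin1\<close> the \<open>cos y\<close> mode of \<open>g(cos y)\<close> is 1 and the mean of \<open>g'(cos y)\<close> is 0, for \<open>nonlin2\<close> it is
  the other way round.\<close>

definition nonlin0 :: "'a :: real_algebra_1 \<Rightarrow> 'a" where
  "nonlin0 z = (1 / 5) *\<^sub>R z ^ 5 - (1 / 3) *\<^sub>R z ^ 3 + (1 / 8) *\<^sub>R z"

definition nonlin1 :: "'a :: real_algebra_1 \<Rightarrow> 'a" where
  "nonlin1 z = 2 *\<^sub>R z - (4 / 3) *\<^sub>R z ^ 3"

definition nonlin2 :: "'a :: real_algebra_1 \<Rightarrow> 'a" where
  "nonlin2 z = (4 / 3) *\<^sub>R z ^ 3 - z"

definition nonlin :: "real \<Rightarrow> real \<Rightarrow> 'a :: real_algebra_1 \<Rightarrow> 'a" where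
  "nonlin p q z = nonlin0 z + p *\<^sub>R nonlin1 z + q *\<^sub>R nonlin2 z"

text \<open>The quotients are written through \<open>b = a + h\<close>, so that \<open>b\<^sup>n - a\<^sup>n\<close> telescopes.\<close>

definition cube_quot :: "'a :: comm_ring_1 \<Rightarrow> 'a \<Rightarrow> 'a" where
  "cube_quot a h = a\<^sup>2 + a * (a + h) + (a + h)\<^sup>2"

definition quint_quot :: "'a :: comm_ring_1 \<Rightarrow> 'a \<Rightarrow> 'a" where
  "quint_quot a h = a ^ 4 + a ^ 3 * (a + h) + a\<^sup>2 * (a + h)\<^sup>2 + a * (a + h) ^ 3 + (a + h) ^ 4"

lemma cube_quot: "(a + h) ^ 3 = a ^ 3 + h * cube_quot a h"
proof -
  have "b ^ 3 = a ^ 3 + (b - a) * cube_quot a (b - a)" for b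
    by (simp add: cube_quot_def algebra_simps eval_nat_numeral)
  from this[of "a + h"] show ?thesis by simp
qed

lemma quint_quot: "(a + h) ^ 5 = a ^ 5 + h * quint_quot a h"
proof -
  have "b ^ 5 = a ^ 5 + (b - a) * quint_quot a (b - a)" for b
    by (simp add: quint_quot_def algebra_simps eval_nat_numeral)
  from this[of "a + h"] show ?thesis by simp
qed

definition nonlin0_quot :: "cos_alg \<Rightarrow> cos_alg \<Rightarrow> cos_alg" where
  "nonlin0_quot a h = (1 / 5) *\<^sub>R quint_quot a h - (1 / 3) *\<^sub>R cube_quot a h + (1 / 8) *\<^sub>R 1"

definition nonlin1_quot :: "cos_alg \<Rightarrow> cos_alg \<Rightarrow> cos_alg" where
  "nonlin1_quot a h = 2 *\<^sub>R 1 - (4 / 3) *\<^sub>R cube_quot a h"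

definition nonlin2_quot :: "cos_alg \<Rightarrow> cos_alg \<Rightarrow> cos_alg" where
  "nonlin2_quot a h = (4 / 3) *\<^sub>R cube_quot a h - 1"

definition nonlin_quot :: "real \<Rightarrow> real \<Rightarrow> cos_alg \<Rightarrow> cos_alg \<Rightarrow> cos_alg" where
  "nonlin_quot p q a h = nonlin0_quot a h + p *\<^sub>R nonlin1_quot a h + q *\<^sub>R nonlin2_quot a h"

lemma nonlin_quot: "nonlin p q (a + h) = nonlin p q a + h * nonlin_quot p q a h"
  unfolding nonlin_def nonlin0_def nonlin1_def nonlin2_def nonlin_quot_def nonlin0_quot_def
    nonlin1_quot_def nonlin2_quot_def cube_quot quint_quot
  by (simp add: algebra_simps)

lemma x_mean_nonlin:
  assumes "x_mean a = a"
  shows "x_mean (nonlin p q a) = nonlin p q a"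
proof -
  interpret bounded_linear x_mean by (rule bounded_linear_x_mean)
  have 1: "x_mean 1 = 1"
    by (rule cos_alg_eqI) (auto simp: coeff_x_mean coeff_one)
  have "x_mean (a ^ n) = a ^ n" for n
    by (induction n) (auto simp: 1 assms intro!: x_mean_times)
  then show ?thesis
    by (simp add: nonlin_def nonlin0_def nonlin1_def nonlin2_def add diff scaleR assms)
qed

lemma eval_power [simp]: "eval (a ^ n) p = eval a p ^ n"
  by (induction n) auto

lemma eval_nonlin: "eval (nonlin p q a) x = nonlin p q (eval a x)"
  by (simp add: nonlin_def nonlin0_def nonlin1_def nonlin2_def)

lemma coeff_nonlin_cos_y:
  "coeff (nonlin0 cos_y) (0, 1) = 0" "coeff (nonlin1 cos_y) (0, 1) = 1 / 2" "coeff (nonlin2 cos_y) (0, 1) = 0"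
  by (simp_all add: nonlin0_def nonlin1_def nonlin2_def cos_y_power3 cos_y_power5 coeff_harmonic)

lemma cos_x_times_harmonic:
  "cos_x * harmonic (0, n) = (1 / 2) *\<^sub>R (harmonic (1, n) + harmonic (1, - n))"
  by (simp add: harmonic_times)

text \<open>With increment 0 the quotient is the derivative, here T_4(cos y) / 8 = cos (4 y) / 8.
  Its product with cos x lives at the frequencies (1, 4), (1, -4) and their negatives, so the second
  solvability condition holds to leading order.\<close>

lemma cos_x_nonlin0_quot:
  "cos_x * nonlin0_quot cos_y 0 = (1 / 16) *\<^sub>R (harmonic (1, 4) + harmonic (1, - 4))"
proof -
  have "quint_quot cos_y 0 = 5 *\<^sub>R cos_y ^ 4" "cube_quot cos_y 0 = 3 *\<^sub>R cos_y ^ 2"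
    by (simp_all add: quint_quot_def cube_quot_def scaleR_conv_of_real eval_nat_numeral)
  then have "nonlin0_quot cos_y 0 = cos_y ^ 4 - cos_y ^ 2 + (1 / 8) *\<^sub>R 1"
    by (simp add: nonlin0_quot_def)
  also have "\<dots> = (1 / 8) *\<^sub>R harmonic (0, 4)"
    unfolding cos_y_power2 cos_y_power4 by (simp add: algebra_simps flip: scaleR_add_left)
  finally show ?thesis
    by (simp add: cos_x_times_harmonic)
qed

lemma cos_x_nonlin1_quot: "cos_x * nonlin1_quot cos_y 0 = - (harmonic (1, 2) + harmonic (1, - 2))"
proof -
  have "cube_quot cos_y 0 = 3 *\<^sub>R cos_y ^ 2"
    by (simp add: cube_quot_def scaleR_conv_of_real eval_nat_numeral)
  then have "nonlin1_quot cos_y 0 = - 2 *\<^sub>R harmonic (0, 2)"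
    unfolding nonlin1_quot_def cos_y_power2 by (intro cos_alg_eqI) (simp add: field_simps)
  then show ?thesis
    by (simp add: cos_x_times_harmonic)
qed

lemma cos_x_nonlin2_quot: "cos_x * nonlin2_quot cos_y 0 = cos_x + (harmonic (1, 2) + harmonic (1, - 2))"
proof -
  have "cube_quot cos_y 0 = 3 *\<^sub>R cos_y ^ 2"
    by (simp add: cube_quot_def scaleR_conv_of_real eval_nat_numeral)
  then have "nonlin2_quot cos_y 0 = 1 + 2 *\<^sub>R harmonic (0, 2)"
    unfolding nonlin2_quot_def cos_y_power2 by (intro cos_alg_eqI) (simp add: field_simps)
  then show ?thesis
    by (simp add: distrib_left cos_x_times_harmonic)
qed

section \<open>The fixed point equation\<close>

lemma approx_cube_quot:
  "approx R n f a \<Longrightarrow> approx R n h b \<Longrightarrow> approx R n (\<lambda>\<delta> x. cube_quot (f \<delta> x) (h \<delta> x) :: cos_alg) (cube_quot a b)"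
  unfolding cube_quot_def by (intro approx_add approx_mult approx_power)

lemma approx_quint_quot:
  "approx R n f a \<Longrightarrow> approx R n h b \<Longrightarrow> approx R n (\<lambda>\<delta> x. quint_quot (f \<delta> x) (h \<delta> x) :: cos_alg) (quint_quot a b)"
  unfolding quint_quot_def by (intro approx_add approx_mult approx_power)

lemma approx_nonlins:
  fixes f :: "real \<Rightarrow> 'z :: real_normed_vector \<Rightarrow> cos_alg"
  assumes "approx R n f a"
  shows "approx R n (\<lambda>\<delta> x. nonlin0 (f \<delta> x)) (nonlin0 a)"
    and "approx R n (\<lambda>\<delta> x. nonlin1 (f \<delta> x)) (nonlin1 a)"
    and "approx R n (\<lambda>\<delta> x. nonlin2 (f \<delta> x)) (nonlin2 a)"
  unfolding nonlin0_def nonlin1_def nonlin2_def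
  by (intro approx_add approx_diff approx_scaleR approx_const approx_power assms)+

lemma approx_nonlin_quots:
  fixes f :: "real \<Rightarrow> 'z :: real_normed_vector \<Rightarrow> cos_alg"
  assumes "approx R n f a" "approx R n h b"
  shows "approx R n (\<lambda>\<delta> x. nonlin0_quot (f \<delta> x) (h \<delta> x)) (nonlin0_quot a b)"
    and "approx R n (\<lambda>\<delta> x. nonlin1_quot (f \<delta> x) (h \<delta> x)) (nonlin1_quot a b)"
    and "approx R n (\<lambda>\<delta> x. nonlin2_quot (f \<delta> x) (h \<delta> x)) (nonlin2_quot a b)"
  unfolding nonlin0_quot_def nonlin1_quot_def nonlin2_quot_def
  by (intro approx_add approx_diff approx_scaleR approx_const approx_cube_quot approx_quint_quot assms)+

text \<open>The unknowns are \<open>(v, w, p, q)\<close>, with \<open>\<epsilon> = \<delta>\<^sup>2\<close> and the coefficients of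
  \<open>nonlin1\<close>, \<open>nonlin2\<close> equal to \<open>\<delta> p\<close>, \<open>\<delta> q\<close>. The square root makes every dependence of the map on the
  unknowns carry a factor \<open>\<delta>\<close>: with coefficients \<open>\<epsilon> p\<close>, \<open>\<epsilon> q\<close> the values of \<open>p\<close>, \<open>q\<close>
  would depend on \<open>v\<close>, \<open>w\<close> to leading order.\<close>

type_synonym unknowns = "cos_alg \<times> cos_alg \<times> real \<times> real"

definition V_of :: "real \<Rightarrow> unknowns \<Rightarrow> cos_alg" where
  "V_of \<delta> z = cos_y + \<delta>\<^sup>2 *\<^sub>R fst z"

definition W_of :: "real \<Rightarrow> unknowns \<Rightarrow> cos_alg" where
  "W_of \<delta> z = cos_x + \<delta>\<^sup>2 *\<^sub>R fst (snd z)"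

definition dW_of :: "real \<Rightarrow> unknowns \<Rightarrow> cos_alg" where
  "dW_of \<delta> z = \<delta>\<^sup>2 *\<^sub>R W_of \<delta> z"

definition p_of :: "unknowns \<Rightarrow> real" where
  "p_of z = fst (snd (snd z))"

definition q_of :: "unknowns \<Rightarrow> real" where
  "q_of z = snd (snd (snd z))"

definition psi_of :: "real \<Rightarrow> unknowns \<Rightarrow> cos_alg" where
  "psi_of \<delta> z = V_of \<delta> z + dW_of \<delta> z"

definition rhs_of :: "real \<Rightarrow> unknowns \<Rightarrow> cos_alg" where
  "rhs_of \<delta> z = nonlin (\<delta> * p_of z) (\<delta> * q_of z) (psi_of \<delta> z)"

text \<open>This is (f(V + \<epsilon> W) - f(V)) / \<epsilon> with the division carried out
  algebraically, so that its limit cos x f'(cos y) can be read off.\<close>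

definition osc_of :: "real \<Rightarrow> unknowns \<Rightarrow> cos_alg" where
  "osc_of \<delta> z = W_of \<delta> z * nonlin_quot (\<delta> * p_of z) (\<delta> * q_of z) (V_of \<delta> z) (dW_of \<delta> z)"

lemma rhs_eq: "rhs_of \<delta> z = nonlin (\<delta> * p_of z) (\<delta> * q_of z) (V_of \<delta> z) + \<delta>\<^sup>2 *\<^sub>R osc_of \<delta> z"
  unfolding rhs_of_def psi_of_def nonlin_quot osc_of_def by (simp add: dW_of_def)

text \<open>For \<delta> > 0 the last two components are fixed exactly when the two solvability
  coefficients vanish. The factor 2 / \<delta> makes them Newton steps: to leading order each
  coefficient changes by \<delta> / 2 per unit of its own parameter, the 1/2 being the coefficient
  of a cosine.\<close>

definition fix_map :: "real \<Rightarrow> unknowns \<Rightarrow> unknowns" where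
  "fix_map \<delta> z =
    (helmholtz_inv (x_mean (rhs_of \<delta> z)),
     helmholtz_inv (osc_of \<delta> z - x_mean (osc_of \<delta> z)),
     p_of z - (2 / \<delta>) * coeff (rhs_of \<delta> z) (0, 1),
     q_of z - (2 / \<delta>) * coeff (osc_of \<delta> z) (1, 0))"

section \<open>Orders in \<delta> of the components of the map\<close>

lemma approx_delta2:
  assumes "bounded_linear (L :: 'z :: real_normed_vector \<Rightarrow> 'a :: real_normed_vector)"
  shows "approx R 2 (\<lambda>\<delta> z. \<delta>\<^sup>2 *\<^sub>R L z) 0"
  using approx_delta_mult[OF approx_fixed[OF assms], of R 2] by (simp add: numeral_2_eq_2)

lemma bounded_linear_unknowns:
  "bounded_linear (\<lambda>z :: unknowns. fst z)" "bounded_linear (\<lambda>z :: unknowns. fst (snd z))"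
  "bounded_linear p_of" "bounded_linear q_of"
  unfolding p_of_def[abs_def] q_of_def[abs_def]
  by (intro bounded_linear_intros)+

lemma approx_V_of: "approx R 2 V_of cos_y"
  using approx_add[OF approx_const[of R 2 cos_y] approx_delta2[OF bounded_linear_unknowns(1)]]
  unfolding V_of_def[abs_def] by simp

lemma approx_W_of: "approx R 2 W_of cos_x"
  using approx_add[OF approx_const[of R 2 cos_x] approx_delta2[OF bounded_linear_unknowns(2)]]
  unfolding W_of_def[abs_def] by simp

lemma approx_dW_of: "approx R 2 dW_of 0"
proof -
  have "approx R 0 W_of 0"
    using approx_mono[OF approx_W_of, of 0] approx_order_0 by blast
  from approx_delta_mult[OF this, of 2] show ?thesis
    unfolding dW_of_def[abs_def] by (simp add: numeral_2_eq_2)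
qed

lemma approx_psi_of: "approx R 2 psi_of cos_y"
  using approx_add[OF approx_V_of approx_dW_of] unfolding psi_of_def[abs_def] by simp

lemma approx_delta_pq: "approx R 1 (\<lambda>\<delta> z. \<delta> * p_of z) 0" "approx R 1 (\<lambda>\<delta> z. \<delta> * q_of z) 0"
  using approx_delta_mult[OF approx_fixed[OF bounded_linear_unknowns(3)], of R 1]
    approx_delta_mult[OF approx_fixed[OF bounded_linear_unknowns(4)], of R 1] by simp_all

lemma approx_pq: "approx R 0 (\<lambda>_. p_of) 0" "approx R 0 (\<lambda>_. q_of) 0"
  by (rule approx_fixed bounded_linear_unknowns)+

lemma approx_rhs_of: "approx R 1 rhs_of (nonlin0 cos_y)"
proof -
  have "approx R 1 (\<lambda>\<delta> z. nonlin0 (psi_of \<delta> z) + (\<delta> * p_of z) *\<^sub>R nonlin1 (psi_of \<delta> z)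
      + (\<delta> * q_of z) *\<^sub>R nonlin2 (psi_of \<delta> z)) (nonlin0 cos_y + 0 *\<^sub>R nonlin1 cos_y + 0 *\<^sub>R nonlin2 cos_y)"
    by (intro approx_add approx_nonlins approx_scaleR approx_delta_pq approx_mono[OF approx_psi_of]) simp_all
  then show ?thesis
    unfolding rhs_of_def[abs_def] nonlin_def by simp
qed

lemma approx_W_nonlin_quots:
  "approx R 2 (\<lambda>\<delta> z. W_of \<delta> z * nonlin0_quot (V_of \<delta> z) (dW_of \<delta> z)) (cos_x * nonlin0_quot cos_y 0)"
  "approx R 2 (\<lambda>\<delta> z. W_of \<delta> z * nonlin1_quot (V_of \<delta> z) (dW_of \<delta> z)) (cos_x * nonlin1_quot cos_y 0)"
  "approx R 2 (\<lambda>\<delta> z. W_of \<delta> z * nonlin2_quot (V_of \<delta> z) (dW_of \<delta> z)) (cos_x * nonlin2_quot cos_y 0)"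
  by (intro approx_mult approx_nonlin_quots approx_V_of approx_dW_of approx_W_of)+

lemma osc_of_eq: "osc_of \<delta> z = W_of \<delta> z * nonlin0_quot (V_of \<delta> z) (dW_of \<delta> z)
    + (\<delta> * p_of z) *\<^sub>R (W_of \<delta> z * nonlin1_quot (V_of \<delta> z) (dW_of \<delta> z))
    + (\<delta> * q_of z) *\<^sub>R (W_of \<delta> z * nonlin2_quot (V_of \<delta> z) (dW_of \<delta> z))"
  by (simp add: osc_of_def nonlin_quot_def distrib_left)

lemma approx_osc_of: "approx R 1 osc_of (cos_x * nonlin0_quot cos_y 0)"
proof -
  have "approx R 1 (\<lambda>\<delta> z. osc_of \<delta> z) (cos_x * nonlin0_quot cos_y 0
      + 0 *\<^sub>R (cos_x * nonlin1_quot cos_y 0) + 0 *\<^sub>R (cos_x * nonlin2_quot cos_y 0))"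
    unfolding osc_of_eq
    by (intro approx_add approx_scaleR approx_delta_pq approx_mono[OF approx_W_nonlin_quots(1)]
        approx_mono[OF approx_W_nonlin_quots(2)] approx_mono[OF approx_W_nonlin_quots(3)]) simp_all
  then show ?thesis by simp
qed

lemma approx_coeff:
  assumes "approx R n f a" "coeff a k = c"
  shows "approx R n (\<lambda>\<delta> z. coeff (f \<delta> z) k) c"
  using approx_bounded_linear[OF bounded_linear_coeff assms(1), of k] assms(2) by simp

text \<open>At frequency (0, 1) the contribution of \<open>nonlin0\<close> vanishes at cos y, so it
  is O(\<delta>^2) and remains O(\<delta>) after the division. The contribution of
  \<open>nonlin1\<close> cancels p up to a factor O(\<delta>^2), and that of \<open>nonlin2\<close>
  multiplies q by O(\<delta>^2).\<close>

lemma approx_fix_p: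
  "approx R 1 (\<lambda>\<delta> z. p_of z - (2 / \<delta>) * coeff (rhs_of \<delta> z) (0, 1)) 0"
proof -
  have n0: "approx R (1 + 1) (\<lambda>\<delta> z. coeff (nonlin0 (psi_of \<delta> z)) (0, 1)) 0"
    using approx_coeff[OF approx_nonlins(1)[OF approx_psi_of] coeff_nonlin_cos_y(1)]
    by (simp add: numeral_2_eq_2)
  have n1: "approx R 2 (\<lambda>\<delta> z. 1 - 2 * coeff (nonlin1 (psi_of \<delta> z)) (0, 1)) (1 - 2 * (1 / 2))"
    by (intro approx_diff approx_mult approx_const approx_coeff[OF approx_nonlins(2)[OF approx_psi_of]] coeff_nonlin_cos_y)
  have n2: "approx R 2 (\<lambda>\<delta> z. coeff (nonlin2 (psi_of \<delta> z)) (0, 1)) 0"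
    by (intro approx_coeff[OF approx_nonlins(3)[OF approx_psi_of]] coeff_nonlin_cos_y)
  have "approx R 1 (\<lambda>\<delta> z. - 2 * ((1 / \<delta> ^ 1) *\<^sub>R coeff (nonlin0 (psi_of \<delta> z)) (0, 1))
      + (1 - 2 * coeff (nonlin1 (psi_of \<delta> z)) (0, 1)) * p_of z
      - 2 * (coeff (nonlin2 (psi_of \<delta> z)) (0, 1) * q_of z)) (- 2 * 0 + 0 - 2 * 0)"
    by (intro approx_add approx_diff approx_mult[of _ _ "\<lambda>_ _. - 2"] approx_mult[of _ _ "\<lambda>_ _. 2"] approx_const
        approx_delta_divide[OF n0] approx_mult_zero[OF _ approx_pq(1)] approx_mult_zero[OF _ approx_pq(2)]
        approx_mono[OF n2] approx_mono[OF n1[simplified]]) simp_all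
  then have "approx R 1 (\<lambda>\<delta> z. p_of z - (2 / \<delta>) * coeff (rhs_of \<delta> z) (0, 1)) (- 2 * 0 + 0 - 2 * 0)"
    by (rule approx_cong) (simp add: rhs_of_def nonlin_def field_simps)
  then show ?thesis by simp
qed

text \<open>The same cancellation at the frequency of cos x, with the roles of
  \<open>nonlin1\<close> and \<open>nonlin2\<close> exchanged.\<close>

lemma approx_fix_q:
  "approx R 1 (\<lambda>\<delta> z. q_of z - (2 / \<delta>) * coeff (osc_of \<delta> z) (1, 0)) 0"
proof -
  have n0: "approx R (1 + 1) (\<lambda>\<delta> z. coeff (W_of \<delta> z * nonlin0_quot (V_of \<delta> z) (dW_of \<delta> z)) (1, 0)) 0"
    using approx_coeff[OF approx_W_nonlin_quots(1), of "(1, 0)" 0]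
    by (simp add: numeral_2_eq_2 cos_x_nonlin0_quot coeff_harmonic)
  have n1: "approx R 2 (\<lambda>\<delta> z. coeff (W_of \<delta> z * nonlin1_quot (V_of \<delta> z) (dW_of \<delta> z)) (1, 0)) 0"
    by (intro approx_coeff[OF approx_W_nonlin_quots(2)]) (simp add: cos_x_nonlin1_quot coeff_harmonic)
  have n2: "approx R 2 (\<lambda>\<delta> z. 1 - 2 * coeff (W_of \<delta> z * nonlin2_quot (V_of \<delta> z) (dW_of \<delta> z)) (1, 0)) (1 - 2 * (1 / 2))"
    by (intro approx_diff approx_mult approx_const approx_coeff[OF approx_W_nonlin_quots(3)])
      (simp add: cos_x_nonlin2_quot coeff_harmonic)
  have "approx R 1 (\<lambda>\<delta> z. - 2 * ((1 / \<delta> ^ 1) *\<^sub>R coeff (W_of \<delta> z * nonlin0_quot (V_of \<delta> z) (dW_of \<delta> z)) (1, 0))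
      - 2 * (coeff (W_of \<delta> z * nonlin1_quot (V_of \<delta> z) (dW_of \<delta> z)) (1, 0) * p_of z)
      + (1 - 2 * coeff (W_of \<delta> z * nonlin2_quot (V_of \<delta> z) (dW_of \<delta> z)) (1, 0)) * q_of z) (- 2 * 0 - 2 * 0 + 0)"
    by (intro approx_add approx_diff approx_mult[of _ _ "\<lambda>_ _. - 2"] approx_mult[of _ _ "\<lambda>_ _. 2"] approx_const
        approx_delta_divide[OF n0] approx_mult_zero[OF _ approx_pq(1)] approx_mult_zero[OF _ approx_pq(2)]
        approx_mono[OF n1] approx_mono[OF n2[simplified]]) simp_all
  then have "approx R 1 (\<lambda>\<delta> z. q_of z - (2 / \<delta>) * coeff (osc_of \<delta> z) (1, 0)) (- 2 * 0 - 2 * 0 + 0)"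
    by (rule approx_cong) (simp add: osc_of_eq field_simps)
  then show ?thesis by simp
qed

definition z_limit :: unknowns where
  "z_limit = (helmholtz_inv (x_mean (nonlin0 cos_y)),
     helmholtz_inv (cos_x * nonlin0_quot cos_y 0 - x_mean (cos_x * nonlin0_quot cos_y 0)), 0, 0)"

lemma approx_fix_map: "approx R 1 fix_map z_limit"
  unfolding fix_map_def[abs_def] z_limit_def
  by (intro approx_Pair approx_fix_p approx_fix_q approx_diff
      approx_bounded_linear[OF bounded_linear_helmholtz_inv] approx_bounded_linear[OF bounded_linear_x_mean]
      approx_rhs_of approx_osc_of)

text \<open>Off the unit frequencies, multiplication by 1 - |k|^2 undoes
  \<open>helmholtz_inv\<close>. At the four unit frequencies the left side is 0, and so is the right
  side, because p and q stay fixed only if the solvability coefficients vanish.\<close>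

lemma fixpoint_helmholtz:
  assumes "\<delta> > 0" "fix_map \<delta> z = z"
  shows "(1 - of_int ((fst k)\<^sup>2 + (snd k)\<^sup>2)) * coeff (psi_of \<delta> z) k = \<delta>\<^sup>2 * coeff (rhs_of \<delta> z) k"
proof -
  obtain v w p q where z: "z = (v, w, p, q)" by (cases z) auto
  have v: "v = helmholtz_inv (x_mean (rhs_of \<delta> z))"
    and w: "w = helmholtz_inv (osc_of \<delta> z - x_mean (osc_of \<delta> z))"
    and p: "coeff (rhs_of \<delta> z) (0, 1) = 0" and q: "coeff (osc_of \<delta> z) (1, 0) = 0"
    using assms by (auto simp: fix_map_def z p_of_def q_of_def)
  interpret x_mean: bounded_linear x_mean by (rule bounded_linear_x_mean)
  have "x_mean v = v"
    unfolding v by (rule cos_alg_eqI) (simp add: coeff_x_mean coeff_helmholtz_inv)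
  moreover have "x_mean cos_y = cos_y"
    by (rule cos_alg_eqI) (auto simp: coeff_x_mean coeff_harmonic)
  ultimately have "x_mean (V_of \<delta> z) = V_of \<delta> z"
    by (simp add: V_of_def x_mean.add x_mean.scaleR z)
  then have mean: "x_mean (nonlin (\<delta> * p_of z) (\<delta> * q_of z) (V_of \<delta> z)) = nonlin (\<delta> * p_of z) (\<delta> * q_of z) (V_of \<delta> z)"
    by (rule x_mean_nonlin)
  let ?F = "rhs_of \<delta> z" and ?K = "osc_of \<delta> z"
  \<comment> \<open>V depends on y alone and so does the nonlinearity at V; the oscillating part
    comes from \<epsilon> times \<open>osc_of\<close> only.\<close>
  have split: "?F = x_mean ?F + \<delta>\<^sup>2 *\<^sub>R (?K - x_mean ?K)"
    unfolding rhs_eq x_mean.add x_mean.scaleR mean by (simp add: algebra_simps)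
  have psi: "psi_of \<delta> z = cos_y + \<delta>\<^sup>2 *\<^sub>R cos_x + \<delta>\<^sup>2 *\<^sub>R helmholtz_inv ?F"
  proof -
    interpret S: bounded_linear helmholtz_inv by (rule bounded_linear_helmholtz_inv)
    have "helmholtz_inv ?F = v + \<delta>\<^sup>2 *\<^sub>R w"
      unfolding v w S.scaleR[symmetric] S.add[symmetric] split[symmetric] ..
    then show ?thesis
      by (simp add: psi_of_def V_of_def dW_of_def W_of_def z algebra_simps)
  qed
  have F10: "coeff ?F (1, 0) = 0"
    by (subst split) (simp add: coeff_x_mean q)
  show ?thesis
  proof (cases "(fst k)\<^sup>2 + (snd k)\<^sup>2 = 1")
    case True
    \<comment> \<open>The integer points of the unit circle; written with minus signs so that
      evenness of the coefficients reduces them to two.\<close>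
    have "k \<in> {(0, 1), - (0, 1), (1, 0), - (1, 0)}"
    proof -
      obtain a b where k: "k = (a, b)" by (cases k)
      have "a\<^sup>2 \<le> 1" "b\<^sup>2 \<le> 1"
        using True zero_le_power2[of a] zero_le_power2[of b] unfolding k fst_conv snd_conv by linarith+
      then have "\<bar>a\<bar> \<le> 1" "\<bar>b\<bar> \<le> 1"
        using abs_le_square_iff[of a 1] abs_le_square_iff[of b 1] by auto
      then have "a \<in> {-1, 0, 1}" "b \<in> {-1, 0, 1}" by auto
      then show ?thesis
        using True by (auto simp: k)
    qed
    then have "coeff ?F k = 0"
      using p F10 by (auto simp del: uminus_Pair)
    then show ?thesis
      using True by simp
  next
    case False
    then have "k \<noteq> (0, 1)" "k \<noteq> (1, 0)" "k \<noteq> - (0, 1)" "k \<noteq> - (1, 0)"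
      by auto
    moreover have "(real_of_int (fst k))\<^sup>2 + (real_of_int (snd k))\<^sup>2 \<noteq> 1"
      using False by (metis of_int_1 of_int_add of_int_eq_iff of_int_power)
    ultimately show ?thesis
      using False unfolding psi by (simp add: coeff_harmonic coeff_helmholtz_inv)
  qed
qed

text \<open>The cosine of frequency \<open>(1, 4)\<close> occurs only in \<open>w\<close>, where \<open>\<Delta> + 1\<close> acts as \<open>-16\<close>.\<close>

lemma coeff_psi_of:
  assumes "fix_map \<delta> z = z" "m = 4 \<or> m = - 4"
  shows "coeff (psi_of \<delta> z) (1, m) = - (\<delta> ^ 4 / 16 * coeff (osc_of \<delta> z) (1, m))"
proof -
  obtain v w p q where z: "z = (v, w, p, q)" by (cases z) auto
  have v: "v = helmholtz_inv (x_mean (rhs_of \<delta> z))"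
    and w: "w = helmholtz_inv (osc_of \<delta> z - x_mean (osc_of \<delta> z))"
    using assms by (auto simp: fix_map_def z p_of_def q_of_def)
  have "coeff v (1, m) = 0"
    unfolding v by (simp add: coeff_helmholtz_inv coeff_x_mean)
  moreover have "coeff w (1, m) = - coeff (osc_of \<delta> z) (1, m) / 16"
    unfolding w using assms(2) by (auto simp: coeff_helmholtz_inv coeff_x_mean)
  ultimately show ?thesis
    using assms(2) by (auto simp: psi_of_def V_of_def dW_of_def W_of_def z coeff_harmonic algebra_simps eval_nat_numeral)
qed

text \<open>A fixed point has \<open>p, q = O(\<delta>)\<close>, which improves the error in \<open>w\<close> from \<open>O(\<delta>)\<close> to \<open>O(\<delta>\<^sup>2) = O(\<epsilon>)\<close>.\<close>

lemma exists_stationary_family: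
  obtains \<delta>0 C where "0 < \<delta>0" "\<delta>0 \<le> 1" "0 < C"
    and "\<And>\<delta>. 0 < \<delta> \<Longrightarrow> \<delta> \<le> \<delta>0 \<Longrightarrow> \<exists>\<psi> p q.
      (\<forall>k. (1 - of_int ((fst k)\<^sup>2 + (snd k)\<^sup>2)) * coeff \<psi> k = \<delta>\<^sup>2 * coeff (nonlin p q \<psi>) k) \<and>
      norm (cos_y - \<psi>) \<le> C * \<delta>\<^sup>2 \<and>
      \<bar>coeff \<psi> (1, 4) + \<delta> ^ 4 / 512\<bar> \<le> C * \<delta> ^ 6 \<and> \<bar>coeff \<psi> (1, - 4) + \<delta> ^ 4 / 512\<bar> \<le> C * \<delta> ^ 6"
proof -
  define R where "R = norm z_limit + 1"
  obtain \<delta>0 where \<delta>0: "0 < \<delta>0" "\<delta>0 \<le> 1"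
    "\<And>\<delta>. 0 < \<delta> \<Longrightarrow> \<delta> \<le> \<delta>0 \<Longrightarrow> \<exists>z. norm z \<le> R \<and> fix_map \<delta> z = z"
    by (rule approx_fixpoint[OF approx_fix_map, of R]) (auto simp: R_def)
  obtain C1 where C1: "approx_with C1 R 2 psi_of cos_y"
    using approx_psi_of unfolding approx_def by blast
  obtain Cp where Cp: "approx_with Cp R 1 (\<lambda>\<delta> z. p_of z - (2 / \<delta>) * coeff (rhs_of \<delta> z) (0, 1)) 0"
    using approx_fix_p unfolding approx_def by blast
  obtain Cq where Cq: "approx_with Cq R 1 (\<lambda>\<delta> z. q_of z - (2 / \<delta>) * coeff (osc_of \<delta> z) (1, 0)) 0"
    using approx_fix_q unfolding approx_def by blast
  let ?a = "\<lambda>\<delta> z. W_of \<delta> z * nonlin0_quot (V_of \<delta> z) (dW_of \<delta> z)"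
  let ?b = "\<lambda>\<delta> z. W_of \<delta> z * nonlin1_quot (V_of \<delta> z) (dW_of \<delta> z)"
  let ?c = "\<lambda>\<delta> z. W_of \<delta> z * nonlin2_quot (V_of \<delta> z) (dW_of \<delta> z)"
  obtain A where A: "approx_with A R 2 ?a (cos_x * nonlin0_quot cos_y 0)"
    using approx_W_nonlin_quots(1) unfolding approx_def by blast
  have "approx R 0 ?b 0"
    by (rule approx_order_0[OF approx_mono[OF approx_W_nonlin_quots(2)]]) simp
  then obtain B where B: "approx_with B R 0 ?b 0"
    unfolding approx_def by blast
  have "approx R 0 ?c 0"
    by (rule approx_order_0[OF approx_mono[OF approx_W_nonlin_quots(3)]]) simp
  then obtain D where D: "approx_with D R 0 ?c 0"
    unfolding approx_def by blast
  note nonneg = approx_withD(1)[OF C1] approx_withD(1)[OF Cp] approx_withD(1)[OF Cq]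
    approx_withD(1)[OF A] approx_withD(1)[OF B] approx_withD(1)[OF D]
  define E where "E = A + Cp * B + Cq * D"
  define C where "C = C1 + E + 1"
  have E0: "E \<ge> 0" using nonneg by (simp add: E_def)
  show thesis
  proof (rule that[OF \<delta>0(1,2)])
    show "0 < C" using nonneg E0 by (simp add: C_def)
    fix \<delta> :: real assume \<delta>: "0 < \<delta>" "\<delta> \<le> \<delta>0"
    then have \<delta>1: "\<delta> \<le> 1" using \<delta>0(2) by simp
    obtain z where z: "norm z \<le> R" "fix_map \<delta> z = z"
      using \<delta>0(3)[OF \<delta>] by blast
    \<comment> \<open>At a fixed point the last two components of the map return p and q themselves,
      so the order 1 bounds on these components bound p and q.\<close>
    have fix_pq: "p_of z - (2 / \<delta>) * coeff (rhs_of \<delta> z) (0, 1) = p_of z"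
      "q_of z - (2 / \<delta>) * coeff (osc_of \<delta> z) (1, 0) = q_of z"
      using z(2) unfolding fix_map_def by (cases z; simp add: p_of_def q_of_def)+
    have p: "\<bar>p_of z\<bar> \<le> Cp * \<delta>" and q: "\<bar>q_of z\<bar> \<le> Cq * \<delta>"
      using approx_withD(2)[OF Cp \<delta>(1) \<delta>1 z(1)] approx_withD(2)[OF Cq \<delta>(1) \<delta>1 z(1)]
      unfolding fix_pq by simp_all
    have osc: "norm (osc_of \<delta> z - cos_x * nonlin0_quot cos_y 0) \<le> E * \<delta>\<^sup>2"
    proof -
      have "osc_of \<delta> z - cos_x * nonlin0_quot cos_y 0 =
          (?a \<delta> z - cos_x * nonlin0_quot cos_y 0) + (\<delta> * p_of z) *\<^sub>R ?b \<delta> z + (\<delta> * q_of z) *\<^sub>R ?c \<delta> z"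
        by (simp add: osc_of_eq)
      also have "norm \<dots> \<le> A * \<delta>\<^sup>2 + (\<delta> * (Cp * \<delta>)) * B + (\<delta> * (Cq * \<delta>)) * D"
      proof (intro norm_triangle_mono)
        show "norm (?a \<delta> z - cos_x * nonlin0_quot cos_y 0) \<le> A * \<delta>\<^sup>2"
          using approx_withD(2)[OF A \<delta>(1) \<delta>1 z(1)] .
        show "norm ((\<delta> * p_of z) *\<^sub>R ?b \<delta> z) \<le> (\<delta> * (Cp * \<delta>)) * B"
          unfolding norm_scaleR abs_mult using approx_withD(2)[OF B \<delta>(1) \<delta>1 z(1)] p \<delta>(1) nonneg
          by (intro mult_mono) auto
        show "norm ((\<delta> * q_of z) *\<^sub>R ?c \<delta> z) \<le> (\<delta> * (Cq * \<delta>)) * D"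
          unfolding norm_scaleR abs_mult using approx_withD(2)[OF D \<delta>(1) \<delta>1 z(1)] q \<delta>(1) nonneg
          by (intro mult_mono) auto
      qed
      finally show ?thesis
        by (simp add: E_def power2_eq_square algebra_simps)
    qed
    have c4: "\<bar>coeff (psi_of \<delta> z) (1, m) + \<delta> ^ 4 / 512\<bar> \<le> C * \<delta> ^ 6" if m: "m = 4 \<or> m = - 4" for m
    proof -
      \<comment> \<open>Half of 1/16, since a cosine has coefficients 1/2; the further factor 1/16
        in \<open>coeff_psi_of\<close> makes 1/512.\<close>
      have "coeff (cos_x * nonlin0_quot cos_y 0) (1, m) = 1 / 32"
        using m by (auto simp: cos_x_nonlin0_quot coeff_harmonic)
      then have "\<bar>coeff (osc_of \<delta> z) (1, m) - 1 / 32\<bar> \<le> E * \<delta>\<^sup>2"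
        using order_trans[OF abs_coeff_le[of "osc_of \<delta> z - cos_x * nonlin0_quot cos_y 0" "(1, m)"] osc] by simp
      from mult_left_mono[OF this, of "\<delta> ^ 4 / 16"]
      have "\<bar>\<delta> ^ 4 / 16 * (coeff (osc_of \<delta> z) (1, m) - 1 / 32)\<bar> \<le> E * \<delta> ^ 6 / 16"
        using \<delta>(1) by (simp add: abs_mult eval_nat_numeral mult_ac)
      moreover have "coeff (psi_of \<delta> z) (1, m) + \<delta> ^ 4 / 512 = - (\<delta> ^ 4 / 16 * (coeff (osc_of \<delta> z) (1, m) - 1 / 32))"
        unfolding coeff_psi_of[OF z(2) m] by (simp add: algebra_simps)
      moreover have "E * \<delta> ^ 6 / 16 \<le> C * \<delta> ^ 6"
        unfolding times_divide_eq_left[symmetric] using nonneg E0 \<delta>(1)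
        by (intro mult_right_mono) (auto simp: C_def)
      ultimately show ?thesis by (simp only: abs_minus_cancel)
    qed
    have "norm (cos_y - psi_of \<delta> z) \<le> C1 * \<delta>\<^sup>2"
      using approx_withD(2)[OF C1 \<delta>(1) \<delta>1 z(1)] by (simp add: norm_minus_commute)
    also have "\<dots> \<le> C * \<delta>\<^sup>2"
      using E0 by (intro mult_right_mono) (auto simp: C_def)
    finally show "\<exists>\<psi> p q.
      (\<forall>k. (1 - of_int ((fst k)\<^sup>2 + (snd k)\<^sup>2)) * coeff \<psi> k = \<delta>\<^sup>2 * coeff (nonlin p q \<psi>) k) \<and>
      norm (cos_y - \<psi>) \<le> C * \<delta>\<^sup>2 \<and>
      \<bar>coeff \<psi> (1, 4) + \<delta> ^ 4 / 512\<bar> \<le> C * \<delta> ^ 6 \<and> \<bar>coeff \<psi> (1, - 4) + \<delta> ^ 4 / 512\<bar> \<le> C * \<delta> ^ 6"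
      using fixpoint_helmholtz[OF \<delta>(1) z(2)] c4[of 4] c4[of "- 4"] unfolding rhs_of_def by blast
  qed
qed

section \<open>Stationary Euler flows\<close>

lemma real_analytic_poly: "real_analytic (poly P)"
  unfolding real_analytic_def
proof (intro allI exI[of _ "1 :: real"] conjI exI impI)
  fix x0 x :: real
  \<comment> \<open>The Taylor expansion at \<open>x0\<close> is the polynomial P(x0 + X).\<close>
  let ?Q = "pcompose P [:x0, 1:]"
  have "(\<lambda>n. poly.coeff ?Q n * (x - x0) ^ n) sums (\<Sum>n\<le>degree ?Q. poly.coeff ?Q n * (x - x0) ^ n)"
    by (rule sums_finite) (auto simp: coeff_eq_0)
  also have "(\<Sum>n\<le>degree ?Q. poly.coeff ?Q n * (x - x0) ^ n) = poly P x"
    by (simp add: poly_pcompose flip: poly_altdef)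
  finally show "(\<lambda>n. poly.coeff ?Q n * (x - x0) ^ n) sums poly P x" .
qed simp

lemma laplacian_eval:
  assumes "\<And>k. - of_int ((fst k)\<^sup>2 + (snd k)\<^sup>2) * coeff a k = coeff b k"
  shows "laplacian (eval a) = eval b"
  unfolding eval_def laplacian_trig_series[OF exp_decay_coeff] assms[symmetric] by simp

lemma eval_gevrey:
  shows "eval a \<in> gevrey_space 1" and "gevrey_norm 1 (eval a) \<le> norm a"
  using gevrey_trig_series[OF exp_decay_coeff[of a], of 1] weighted_coeff_summable[of a]
  by (auto simp: eval_def norm_cos_alg_def)

text \<open>A derivative costs a factor \<open>freq_l1\<close>, paid for by lowering the rate from 1
  to s: x \<le> exp ((1 - s) x) / (1 - s). Velocities are derivatives of the stream function, hence
  their closeness is measured with s < 1.\<close>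

lemma gevrey_derivative:
  assumes "\<And>k. cmod (d k) \<le> freq_l1 k * \<bar>coeff a k\<bar>" "\<And>k. d (- k) = cnj (d k)" "0 < s" "s < 1"
  shows "trig_series d \<in> gevrey_space s" and "gevrey_norm s (trig_series d) \<le> norm a / (1 - s)"
proof -
  have decay: "exp_decay d"
    using exp_decay_coeff[of a] by (rule exp_decay_weighted[where n = 1]) (use assms(1) in simp)
  have le: "exp (s * freq_l1 k) * cmod (d k) \<le> (exp (freq_l1 k) * \<bar>coeff a k\<bar>) / (1 - s)" for k
  proof -
    have "(1 - s) * freq_l1 k \<le> exp ((1 - s) * freq_l1 k)"
      using exp_ge_add_one_self[of "(1 - s) * freq_l1 k"] by linarith
    then have "freq_l1 k \<le> exp ((1 - s) * freq_l1 k) / (1 - s)"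
      using assms(4) by (simp add: field_simps)
    then have "cmod (d k) \<le> exp ((1 - s) * freq_l1 k) / (1 - s) * \<bar>coeff a k\<bar>"
      by (rule order_trans[OF assms(1)[of k] mult_right_mono]) simp
    then have "exp (s * freq_l1 k) * cmod (d k) \<le>
        exp (s * freq_l1 k) * (exp ((1 - s) * freq_l1 k) / (1 - s) * \<bar>coeff a k\<bar>)"
      by (rule mult_left_mono) simp
    also have "\<dots> = (exp (s * freq_l1 k) * exp ((1 - s) * freq_l1 k)) * \<bar>coeff a k\<bar> / (1 - s)"
      by simp
    also have "exp (s * freq_l1 k) * exp ((1 - s) * freq_l1 k) = exp (freq_l1 k)"
      by (simp add: algebra_simps flip: exp_add)
    finally show ?thesis .
  qed
  have hs: "((\<lambda>k. (exp (freq_l1 k) * \<bar>coeff a k\<bar>) / (1 - s)) has_sum norm a / (1 - s)) UNIV"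
    unfolding norm_cos_alg_def by (intro has_sum_divide_const has_sum_infsum weighted_coeff_summable)
  have sm: "(\<lambda>k. exp (s * freq_l1 k) * cmod (d k)) summable_on UNIV"
    by (rule summable_on_comparison_test[OF has_sum_imp_summable[OF hs] le]) auto
  show "trig_series d \<in> gevrey_space s"
    using assms(3) by (intro gevrey_trig_series decay assms(2) sm) simp
  have "gevrey_norm s (trig_series d) \<le> (\<Sum>\<^sub>\<infinity>k. exp (s * freq_l1 k) * cmod (d k))"
    using assms(3) by (intro gevrey_trig_series decay assms(2) sm) simp
  also have "\<dots> \<le> norm a / (1 - s)"
    by (rule has_sum_mono[OF has_sum_infsum[OF sm] hs le])
  finally show "gevrey_norm s (trig_series d) \<le> norm a / (1 - s)" .
qed

lemma C1_funI:
  assumes "\<And>p. (f has_derivative (\<lambda>h. fst h * fx p + snd h * fy p)) (at p)"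
    and "continuous_on UNIV fx" "continuous_on UNIV fy"
  shows "C1_fun f" "dx f = fx" "dy f = fy"
proof -
  show "dx f = fx" "dy f = fy"
    using dx_eqI[OF assms(1)] dy_eqI[OF assms(1)] by blast+
  then show "C1_fun f"
    using assms unfolding C1_fun_def differentiable_def by metis
qed

text \<open>F(f) \<nabla> f is the gradient of G(f). So the convective term is a gradient, which the
  pressure balances.\<close>

lemma stationary_euler_grad_perp:
  assumes c: "exp_decay c" and f: "f = trig_series c"
    and lap: "\<And>p. laplacian f p = F (f p)"
    and G: "\<And>z. (G has_real_derivative F z) (at z)" and F: "continuous_on UNIV F"
  shows "stationary_euler (grad_perp f)"
proof -
  define a where "a = trig_series (dx_coeff c)"
  define b where "b = trig_series (dy_coeff c)"
  define ax where "ax = trig_series (dx_coeff (dx_coeff c))"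
  define ay where "ay = trig_series (dy_coeff (dx_coeff c))"
  define bx where "bx = trig_series (dx_coeff (dy_coeff c))"
  define b_y where "b_y = trig_series (dy_coeff (dy_coeff c))"
  \<comment> \<open>Bernoulli: \<open>(U \<cdot> \<nabla>) U = \<nabla> (\<bar>\<nabla> f\<bar>\<^sup>2 / 2) - (\<Delta> f) \<nabla> f\<close>.\<close>
  define P where "P p = G (f p) - ((a p)\<^sup>2 + (b p)\<^sup>2) / 2" for p
  note decay = exp_decay_dx_coeff exp_decay_dy_coeff c
  have fd: "(f has_derivative (\<lambda>h. fst h * a p + snd h * b p)) (at p)"
    and ad: "(a has_derivative (\<lambda>h. fst h * ax p + snd h * ay p)) (at p)"
    and bd: "(b has_derivative (\<lambda>h. fst h * bx p + snd h * b_y p)) (at p)" for p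
    unfolding a_def b_def ax_def ay_def bx_def b_y_def f by (intro trig_series_has_derivative decay)+
  have cont: "continuous_on UNIV f" "continuous_on UNIV a" "continuous_on UNIV b" "continuous_on UNIV ax"
     "continuous_on UNIV ay" "continuous_on UNIV bx" "continuous_on UNIV b_y"
    unfolding a_def b_def ax_def ay_def bx_def b_y_def f by (intro continuous_on_trig_series decay)+
  have tor: "torus_fun f" "torus_fun a" "torus_fun b"
    unfolding a_def b_def f by (rule torus_fun_trig_series)+
  \<comment> \<open>Symmetry of mixed derivatives, read off the coefficients.\<close>
  have ay: "ay = bx"
    unfolding ay_def bx_def by (simp add: dx_coeff_def[abs_def] dy_coeff_def[abs_def] mult_ac)
  have U: "grad_perp f = (\<lambda>p. (- b p, a p))"
    unfolding grad_perp_def a_def b_def f by (simp add: dx_trig_series dy_trig_series c)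
  have lap': "F (f p) = ax p + b_y p" for p
    using lap[of p] unfolding laplacian_def ax_def b_y_def f
    by (simp add: dx_trig_series dy_trig_series decay)
  have "((\<lambda>p. - b p) has_derivative (\<lambda>h. fst h * (- bx p) + snd h * (- b_y p))) (at p)" for p
    by (rule has_derivative_eq_rhs, rule has_derivative_minus[OF bd]) auto
  note U1 = C1_funI[OF this, OF continuous_on_minus continuous_on_minus, OF cont(6,7)]
  note U2 = C1_funI[OF ad cont(4,5)]
  have contF: "continuous_on UNIV (\<lambda>p. F (f p))"
    using continuous_on_compose2[OF F cont(1)] by simp
  have P: "(P has_derivative (\<lambda>h. fst h * (F (f p) * a p - a p * ax p - b p * bx p)
      + snd h * (F (f p) * b p - a p * ay p - b p * b_y p))) (at p)" for p
    unfolding P_def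
    by (rule has_derivative_eq_rhs, (rule derivative_intros DERIV_compose_FDERIV[OF G fd] ad bd | simp)+)
      (auto simp: algebra_simps)
  have P': "C1_fun P" "dx P = (\<lambda>p. F (f p) * a p - a p * ax p - b p * bx p)"
    "dy P = (\<lambda>p. F (f p) * b p - a p * ay p - b p * b_y p)"
    by (rule C1_funI[OF P]; intro continuous_intros contF cont)+
  have "torus_fun P" "torus_fun (grad_perp f)"
    using tor unfolding torus_fun_def P_def U by simp_all
  moreover have "fst \<circ> grad_perp f = (\<lambda>p. - b p)" "snd \<circ> grad_perp f = a"
    by (auto simp: U)
  ultimately have "euler_solution (\<lambda>t. grad_perp f) (\<lambda>t. P)"
    unfolding euler_solution_def by (simp add: U1 U2 P' U lap' ay algebra_simps)
  then show ?thesis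
    unfolding stationary_euler_def by blast
qed

lemma fourier_coeff_zero: "fourier_coeff (\<lambda>_. 0) k = 0"
  by (simp add: fourier_coeff_eq)

lemma fourier_coeff_dx_eval: "fourier_coeff (dx (eval a)) k = \<i> * of_int (fst k) * of_real (coeff a k)"
  unfolding eval_def dx_trig_series[OF exp_decay_coeff]
  by (subst fourier_coeff_trig_series[OF exp_decay_summable[OF exp_decay_dx_coeff[OF exp_decay_coeff]]])
    (simp add: dx_coeff_def)

lemma fourier_coeff_dy_eval: "fourier_coeff (dy (eval a)) k = \<i> * of_int (snd k) * of_real (coeff a k)"
  unfolding eval_def dy_trig_series[OF exp_decay_coeff]
  by (subst fourier_coeff_trig_series[OF exp_decay_summable[OF exp_decay_dy_coeff[OF exp_decay_coeff]]])
    (simp add: dy_coeff_def)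

text \<open>\<open>shear_flow\<close> admits any stream function of the flow, so first derivatives
  are compared. One of them would vanish identically, whereas a mode with both frequencies nonzero
  is visible in both.\<close>

lemma not_shear_flow_eval:
  assumes "coeff a k \<noteq> 0" "fst k \<noteq> 0" "snd k \<noteq> 0"
  shows "\<not> shear_flow (grad_perp (eval a))"
proof
  assume "shear_flow (grad_perp (eval a))"
  then obtain \<psi> where eq: "grad_perp (eval a) = grad_perp \<psi>"
    and g: "(\<exists>g. \<forall>x y. \<psi> (x, y) = g x) \<or> (\<exists>g. \<forall>x y. \<psi> (x, y) = g y)"
    unfolding shear_flow_def by blast
  have "dy (eval a) = dy \<psi>" "dx (eval a) = dx \<psi>"
    using eq unfolding grad_perp_def by (metis Pair_inject ext neg_equal_iff_equal)+
  moreover have "dy \<psi> = (\<lambda>_. 0) \<or> dx \<psi> = (\<lambda>_. 0)"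
    using g by (auto simp: dx_def dy_def)
  ultimately show False
    using fourier_coeff_dx_eval[of a k] fourier_coeff_dy_eval[of a k] assms by (auto simp: fourier_coeff_zero)
qed

text \<open>For a member of the kernel the coefficients of \<open>(1 + \<Delta>\<^sup>-\<^sup>1) \<partial>\<^sub>x\<close> at \<open>(1, l)\<close> are 2-periodic in \<open>l\<close>, and the
  one at \<open>(1, 0)\<close> vanishes.\<close>

lemma eval_notin_ker_LK:
  assumes "coeff a (1, 4) \<noteq> 0"
  shows "eval a \<notin> ker_LK"
proof
  assume "eval a \<in> ker_LK"
  then have LK: "LK_hat (fourier_coeff (eval a)) k = 0" for k
    unfolding ker_LK_def by blast
  define D where "D = (\<lambda>k. dx_hat (fourier_coeff (eval a)) k + inv_laplacian_hat (dx_hat (fourier_coeff (eval a))) k)"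
  have "D (1, 0) = D (1, 2)" "D (1, 2) = D (1, 4)"
    using LK[of "(1, 1)"] LK[of "(1, 3)"] by (auto simp: LK_hat_def sin_y_hat_def D_def)
  \<comment> \<open>The multiplier of 1 + \<Delta>^-1 is 1 - 1 / |k|^2, which is 0 at (1, 0) and
    16/17 at (1, 4).\<close>
  moreover have "D (1, 0) = 0"
    by (simp add: D_def dx_hat_def inv_laplacian_hat_def)
  moreover have "D (1, 4) \<noteq> 0"
    using assms by (simp add: D_def dx_hat_def inv_laplacian_hat_def fourier_coeff_eval field_simps)
  ultimately show False by simp
qed

theorem theorem1:
  "\<exists>\<epsilon>0 > 0. \<exists>r > 0. \<exists>M > 0.
   \<exists>(\<Psi> :: real \<Rightarrow> real \<times> real \<Rightarrow> real) (F :: real \<Rightarrow> real \<Rightarrow> real).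
     (\<forall>\<epsilon>. 0 < \<epsilon> \<and> \<epsilon> \<le> \<epsilon>0 \<longrightarrow>
        torus_fun (\<Psi> \<epsilon>) \<and> real_analytic2 (\<Psi> \<epsilon>) \<and> real_analytic (F \<epsilon>) \<and>
        (\<forall>p. laplacian (\<Psi> \<epsilon>) p = F \<epsilon> (\<Psi> \<epsilon> p)) \<and>
        (\<lambda>p. cos (snd p) - \<Psi> \<epsilon> p) \<in> gevrey_space r \<and>
        gevrey_norm r (\<lambda>p. cos (snd p) - \<Psi> \<epsilon> p) \<le> M * \<epsilon>) \<and>
     (\<lambda>\<epsilon>. torus_inner (\<Psi> \<epsilon>) (\<lambda>(x, y). cos x * cos (4 * y)) - (- \<epsilon>\<^sup>2 * (pi\<^sup>2 / 128)))
        \<in> O[at_right 0](\<lambda>\<epsilon>. \<epsilon> ^ 3) \<and>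
     (\<forall>\<epsilon>. 0 < \<epsilon> \<and> \<epsilon> \<le> \<epsilon>0 \<longrightarrow>
        stationary_euler (grad_perp (\<Psi> \<epsilon>)) \<and>
        \<not> shear_flow (grad_perp (\<Psi> \<epsilon>)) \<and>
        laplacian (\<Psi> \<epsilon>) \<notin> ker_LK) \<and>
     (\<forall>s \<delta>. 0 < s \<and> s < r \<and> 0 < \<delta> \<longrightarrow>
        (\<forall>\<^sub>F \<epsilon> in at_right 0.
           (\<lambda>p. fst (kolmogorov_flow p - grad_perp (\<Psi> \<epsilon>) p)) \<in> gevrey_space s \<and>
           (\<lambda>p. snd (kolmogorov_flow p - grad_perp (\<Psi> \<epsilon>) p)) \<in> gevrey_space s \<and>
           gevrey_norm s (\<lambda>p. fst (kolmogorov_flow p - grad_perp (\<Psi> \<epsilon>) p)) < \<delta> \<and>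
           gevrey_norm s (\<lambda>p. snd (kolmogorov_flow p - grad_perp (\<Psi> \<epsilon>) p)) < \<delta>))"
proof -
  obtain \<delta>0 C where \<delta>0: "0 < \<delta>0" "0 < C"
    and fam: "\<And>\<delta>. 0 < \<delta> \<Longrightarrow> \<delta> \<le> \<delta>0 \<Longrightarrow> \<exists>\<psi> p q.
      (\<forall>k. (1 - of_int ((fst k)\<^sup>2 + (snd k)\<^sup>2)) * coeff \<psi> k = \<delta>\<^sup>2 * coeff (nonlin p q \<psi>) k) \<and>
      norm (cos_y - \<psi>) \<le> C * \<delta>\<^sup>2 \<and>
      \<bar>coeff \<psi> (1, 4) + \<delta> ^ 4 / 512\<bar> \<le> C * \<delta> ^ 6 \<and> \<bar>coeff \<psi> (1, - 4) + \<delta> ^ 4 / 512\<bar> \<le> C * \<delta> ^ 6"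
    by (rule exists_stationary_family) blast
  \<comment> \<open>The first bound reflects \<delta> = sqrt \<epsilon>. The second keeps the error
    C \<epsilon>^3 at or below half of \<epsilon>^2 / 512, so the coefficient at (1, 4) cannot
    vanish.\<close>
  define \<epsilon>0 where "\<epsilon>0 = min (\<delta>0\<^sup>2) (1 / (1024 * C))"
  have \<epsilon>0: "0 < \<epsilon>0" using \<delta>0 by (simp add: \<epsilon>0_def)
  \<comment> \<open>The range of \<epsilon> is a premise inside the existential, so that choice
    yields functions defined for every real \<epsilon>.\<close>
  have "\<exists>\<psi> p q. 0 < \<epsilon> \<and> \<epsilon> \<le> \<epsilon>0 \<longrightarrow>
      (\<forall>k. (1 - of_int ((fst k)\<^sup>2 + (snd k)\<^sup>2)) * coeff \<psi> k = \<epsilon> * coeff (nonlin p q \<psi>) k) \<and>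
      norm (cos_y - \<psi>) \<le> C * \<epsilon> \<and>
      \<bar>coeff \<psi> (1, 4) + \<epsilon>\<^sup>2 / 512\<bar> \<le> C * \<epsilon> ^ 3 \<and> \<bar>coeff \<psi> (1, - 4) + \<epsilon>\<^sup>2 / 512\<bar> \<le> C * \<epsilon> ^ 3" for \<epsilon>
  proof (cases "0 < \<epsilon> \<and> \<epsilon> \<le> \<epsilon>0")
    case True
    have "sqrt \<epsilon> \<le> sqrt (\<delta>0\<^sup>2)"
      using True by (intro real_sqrt_le_mono) (simp add: \<epsilon>0_def)
    then have "sqrt \<epsilon> \<le> \<delta>0" using \<delta>0 by simp
    moreover have "sqrt \<epsilon> ^ 4 = \<epsilon>\<^sup>2" "sqrt \<epsilon> ^ 6 = \<epsilon> ^ 3" "(sqrt \<epsilon>)\<^sup>2 = \<epsilon>"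
      using True power_mult[of "sqrt \<epsilon>" 2 2] power_mult[of "sqrt \<epsilon>" 2 3] by simp_all
    ultimately show ?thesis
      using fam[of "sqrt \<epsilon>"] True by simp
  qed blast
  then obtain \<psi> p q where
    all: "\<And>\<epsilon>. 0 < \<epsilon> \<and> \<epsilon> \<le> \<epsilon>0 \<longrightarrow>
      (\<forall>k. (1 - of_int ((fst k)\<^sup>2 + (snd k)\<^sup>2)) * coeff (\<psi> \<epsilon>) k = \<epsilon> * coeff (nonlin (p \<epsilon>) (q \<epsilon>) (\<psi> \<epsilon>)) k) \<and>
      norm (cos_y - \<psi> \<epsilon>) \<le> C * \<epsilon> \<and>
      \<bar>coeff (\<psi> \<epsilon>) (1, 4) + \<epsilon>\<^sup>2 / 512\<bar> \<le> C * \<epsilon> ^ 3 \<and> \<bar>coeff (\<psi> \<epsilon>) (1, - 4) + \<epsilon>\<^sup>2 / 512\<bar> \<le> C * \<epsilon> ^ 3"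
    by metis
  have eqn: "(1 - of_int ((fst k)\<^sup>2 + (snd k)\<^sup>2)) * coeff (\<psi> \<epsilon>) k = \<epsilon> * coeff (nonlin (p \<epsilon>) (q \<epsilon>) (\<psi> \<epsilon>)) k"
    and close: "norm (cos_y - \<psi> \<epsilon>) \<le> C * \<epsilon>"
    and c4: "\<bar>coeff (\<psi> \<epsilon>) (1, 4) + \<epsilon>\<^sup>2 / 512\<bar> \<le> C * \<epsilon> ^ 3"
    and c4': "\<bar>coeff (\<psi> \<epsilon>) (1, - 4) + \<epsilon>\<^sup>2 / 512\<bar> \<le> C * \<epsilon> ^ 3"
    if "0 < \<epsilon>" "\<epsilon> \<le> \<epsilon>0" for \<epsilon> k
    using all[of \<epsilon>] that by blast+
  define \<Psi> where "\<Psi> \<epsilon> = eval (\<psi> \<epsilon>)" for \<epsilon>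
  define b where "b \<epsilon> = \<epsilon> *\<^sub>R nonlin (p \<epsilon>) (q \<epsilon>) (\<psi> \<epsilon>) - \<psi> \<epsilon>" for \<epsilon>
  define F where "F \<epsilon> z = \<epsilon> * nonlin (p \<epsilon>) (q \<epsilon>) z - z" for \<epsilon> z :: real
  define G where "G \<epsilon> z = \<epsilon> * (z ^ 6 / 30 - z ^ 4 / 12 + z\<^sup>2 / 16 + p \<epsilon> * (z\<^sup>2 - z ^ 4 / 3) + q \<epsilon> * (z ^ 4 / 3 - z\<^sup>2 / 2)) - z\<^sup>2 / 2"
    for \<epsilon> z :: real
  have F_poly: "F \<epsilon> = poly [:0, \<epsilon> * (1 / 8 + 2 * p \<epsilon> - q \<epsilon>) - 1, 0, \<epsilon> * (4 / 3 * (q \<epsilon> - p \<epsilon>) - 1 / 3), 0, \<epsilon> / 5:]" for \<epsilon>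
    by (rule ext) (simp add: F_def nonlin_def nonlin0_def nonlin1_def nonlin2_def field_simps eval_nat_numeral)
  have G: "(G \<epsilon> has_real_derivative F \<epsilon> z) (at z)" for \<epsilon> z
    unfolding G_def[abs_def] F_def nonlin_def nonlin0_def nonlin1_def nonlin2_def
    by (auto intro!: derivative_eq_intros simp: algebra_simps)
  have contF: "continuous_on UNIV (F \<epsilon>)" for \<epsilon>
    unfolding F_poly by (intro continuous_intros)
  have lap: "laplacian (\<Psi> \<epsilon>) = eval (b \<epsilon>)" if "0 < \<epsilon>" "\<epsilon> \<le> \<epsilon>0" for \<epsilon>
    unfolding \<Psi>_def
  proof (rule laplacian_eval)
    show "- of_int ((fst k)\<^sup>2 + (snd k)\<^sup>2) * coeff (\<psi> \<epsilon>) k = coeff (b \<epsilon>) k" for k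
      using eqn[OF that, of k] by (simp add: b_def algebra_simps)
  qed
  have lapF: "laplacian (\<Psi> \<epsilon>) x = F \<epsilon> (\<Psi> \<epsilon> x)" if "0 < \<epsilon>" "\<epsilon> \<le> \<epsilon>0" for \<epsilon> x
    unfolding lap[OF that] by (simp add: b_def F_def eval_nonlin \<Psi>_def)
  have diff: "(\<lambda>x. cos (snd x) - \<Psi> \<epsilon> x) = eval (cos_y - \<psi> \<epsilon>)" for \<epsilon>
    by (rule ext) (simp add: \<Psi>_def eval_harmonic phase_def)
  have nonzero: "coeff (\<psi> \<epsilon>) (1, 4) \<noteq> 0" if \<epsilon>: "0 < \<epsilon>" "\<epsilon> \<le> \<epsilon>0" for \<epsilon>
  proof
    assume "coeff (\<psi> \<epsilon>) (1, 4) = 0"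
    then have "\<epsilon>\<^sup>2 * (1 / 512) \<le> \<epsilon>\<^sup>2 * (C * \<epsilon>)"
      using c4[OF \<epsilon>] by (simp add: eval_nat_numeral mult_ac)
    then have "1 / 512 \<le> C * \<epsilon>"
      using \<epsilon>(1) by simp
    moreover have "C * \<epsilon> \<le> 1 / 1024"
      using \<epsilon>(2) \<delta>0(2) by (auto simp: \<epsilon>0_def field_simps)
    ultimately show False by simp
  qed
  have main: "torus_fun (\<Psi> \<epsilon>) \<and> real_analytic2 (\<Psi> \<epsilon>) \<and> real_analytic (F \<epsilon>) \<and>
        (\<forall>p. laplacian (\<Psi> \<epsilon>) p = F \<epsilon> (\<Psi> \<epsilon> p)) \<and>
        (\<lambda>p. cos (snd p) - \<Psi> \<epsilon> p) \<in> gevrey_space 1 \<and>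
        gevrey_norm 1 (\<lambda>p. cos (snd p) - \<Psi> \<epsilon> p) \<le> C * \<epsilon>" if "0 < \<epsilon>" "\<epsilon> \<le> \<epsilon>0" for \<epsilon>
  proof (intro conjI allI)
    show "torus_fun (\<Psi> \<epsilon>)" "real_analytic2 (\<Psi> \<epsilon>)"
      unfolding \<Psi>_def eval_def by (intro torus_fun_trig_series real_analytic2_trig_series exp_decay_coeff)+
    show "real_analytic (F \<epsilon>)"
      unfolding F_poly by (rule real_analytic_poly)
    show "laplacian (\<Psi> \<epsilon>) p = F \<epsilon> (\<Psi> \<epsilon> p)" for p
      using lapF[OF that] .
    show "(\<lambda>p. cos (snd p) - \<Psi> \<epsilon> p) \<in> gevrey_space 1"
      unfolding diff by (rule eval_gevrey)
    show "gevrey_norm 1 (\<lambda>p. cos (snd p) - \<Psi> \<epsilon> p) \<le> C * \<epsilon>"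
      unfolding diff using eval_gevrey(2) close[OF that] by (rule order_trans)
  qed
  have inner: "(\<lambda>\<epsilon>. torus_inner (\<Psi> \<epsilon>) (\<lambda>(x, y). cos x * cos (4 * y)) - (- \<epsilon>\<^sup>2 * (pi\<^sup>2 / 128)))
        \<in> O[at_right 0](\<lambda>\<epsilon>. \<epsilon> ^ 3)"
  \<comment> \<open>Two coefficients, each with error C \<epsilon>^3, times 2 pi^2; likewise twice
    1/512 times 2 pi^2 is pi^2 / 128.\<close>
  proof (rule bigoI[where c = "4 * pi\<^sup>2 * C"])
    have "norm (torus_inner (\<Psi> \<epsilon>) (\<lambda>(x, y). cos x * cos (4 * y)) - (- \<epsilon>\<^sup>2 * (pi\<^sup>2 / 128))) \<le> 4 * pi\<^sup>2 * C * norm (\<epsilon> ^ 3)"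
      if \<epsilon>: "0 < \<epsilon>" "\<epsilon> \<le> \<epsilon>0" for \<epsilon>
    proof -
      have "torus_inner (\<Psi> \<epsilon>) (\<lambda>(x, y). cos x * cos (4 * y)) = 2 * pi\<^sup>2 * (coeff (\<psi> \<epsilon>) (1, 4) + coeff (\<psi> \<epsilon>) (1, - 4))"
        using torus_inner_cos_cos[OF exp_decay_coeff, of "\<psi> \<epsilon>" 1 4]
        unfolding \<Psi>_def eval_def[symmetric] fourier_coeff_eval by simp
      then have "torus_inner (\<Psi> \<epsilon>) (\<lambda>(x, y). cos x * cos (4 * y)) - (- \<epsilon>\<^sup>2 * (pi\<^sup>2 / 128)) =
          2 * pi\<^sup>2 * ((coeff (\<psi> \<epsilon>) (1, 4) + \<epsilon>\<^sup>2 / 512) + (coeff (\<psi> \<epsilon>) (1, - 4) + \<epsilon>\<^sup>2 / 512))"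
        by (simp add: algebra_simps)
      also have "norm \<dots> \<le> 2 * pi\<^sup>2 * (C * \<epsilon> ^ 3 + C * \<epsilon> ^ 3)"
        unfolding norm_mult using c4[OF \<epsilon>] c4'[OF \<epsilon>]
        by (intro mult_mono) (auto intro: abs_triangle_ineq[THEN order_trans])
      finally show ?thesis
        using \<epsilon>(1) by (simp add: algebra_simps)
    qed
    then show "\<forall>\<^sub>F \<epsilon> in at_right 0. norm (torus_inner (\<Psi> \<epsilon>) (\<lambda>(x, y). cos x * cos (4 * y)) - (- \<epsilon>\<^sup>2 * (pi\<^sup>2 / 128)))
        \<le> 4 * pi\<^sup>2 * C * norm (\<epsilon> ^ 3)"
      using eventually_at_right_real[OF \<epsilon>0] by (auto elim!: eventually_mono)
  qed
  have euler: "stationary_euler (grad_perp (\<Psi> \<epsilon>)) \<and> \<not> shear_flow (grad_perp (\<Psi> \<epsilon>)) \<and> laplacian (\<Psi> \<epsilon>) \<notin> ker_LK"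
    if \<epsilon>: "0 < \<epsilon>" "\<epsilon> \<le> \<epsilon>0" for \<epsilon>
  proof (intro conjI)
    show "stationary_euler (grad_perp (\<Psi> \<epsilon>))"
      by (rule stationary_euler_grad_perp[OF exp_decay_coeff _ lapF[OF \<epsilon>] G contF]) (simp add: \<Psi>_def eval_def)
    show "\<not> shear_flow (grad_perp (\<Psi> \<epsilon>))"
      unfolding \<Psi>_def using nonzero[OF \<epsilon>] by (rule not_shear_flow_eval) auto
    \<comment> \<open>The eigenvalue of the Laplacian at (1, 4) is - (1 + 16).\<close>
    have "coeff (b \<epsilon>) (1, 4) = - 17 * coeff (\<psi> \<epsilon>) (1, 4)"
      using eqn[OF \<epsilon>, of "(1, 4)"] by (simp add: b_def)
    then show "laplacian (\<Psi> \<epsilon>) \<notin> ker_LK"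
      unfolding lap[OF \<epsilon>] using nonzero[OF \<epsilon>] by (intro eval_notin_ker_LK) simp
  qed
  have near: "\<forall>\<^sub>F \<epsilon> in at_right 0.
           (\<lambda>p. fst (kolmogorov_flow p - grad_perp (\<Psi> \<epsilon>) p)) \<in> gevrey_space s \<and>
           (\<lambda>p. snd (kolmogorov_flow p - grad_perp (\<Psi> \<epsilon>) p)) \<in> gevrey_space s \<and>
           gevrey_norm s (\<lambda>p. fst (kolmogorov_flow p - grad_perp (\<Psi> \<epsilon>) p)) < \<delta> \<and>
           gevrey_norm s (\<lambda>p. snd (kolmogorov_flow p - grad_perp (\<Psi> \<epsilon>) p)) < \<delta>"
    if s: "0 < s" "s < 1" and "0 < \<delta>" for s \<delta>
  proof -
    \<comment> \<open>Chosen so that C \<epsilon> / (1 - s) < \<delta>; dividing by 1 - s is the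
      price of a derivative in \<open>gevrey_derivative\<close>.\<close>
    define e where "e = min \<epsilon>0 (\<delta> * (1 - s) / C)"
    have "0 < e" using \<epsilon>0 s \<open>0 < \<delta>\<close> \<delta>0 by (simp add: e_def)
    moreover have "(\<lambda>p. fst (kolmogorov_flow p - grad_perp (\<Psi> \<epsilon>) p)) \<in> gevrey_space s \<and>
           (\<lambda>p. snd (kolmogorov_flow p - grad_perp (\<Psi> \<epsilon>) p)) \<in> gevrey_space s \<and>
           gevrey_norm s (\<lambda>p. fst (kolmogorov_flow p - grad_perp (\<Psi> \<epsilon>) p)) < \<delta> \<and>
           gevrey_norm s (\<lambda>p. snd (kolmogorov_flow p - grad_perp (\<Psi> \<epsilon>) p)) < \<delta>"
      if \<epsilon>: "0 < \<epsilon>" "\<epsilon> < e" for \<epsilon>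
    proof -
      define c where "c k = complex_of_real (coeff (cos_y - \<psi> \<epsilon>) k)" for k
      \<comment> \<open>The first velocity component is minus the y-derivative of the stream
        function. As cos y is the stream function of the Kolmogorov flow, \<open>d\<close> and
        \<open>dx_coeff c\<close> represent the two components of the velocity difference.\<close>
      define d where "d k = - dy_coeff c k" for k
      have c: "exp_decay c" unfolding c_def by (rule exp_decay_coeff)
      have E: "trig_series c = (\<lambda>x. cos (snd x) - \<Psi> \<epsilon> x)"
        unfolding diff eval_def c_def ..
      have \<Psi>d: "(\<Psi> \<epsilon> has_derivative (\<lambda>h. fst h * dx (\<Psi> \<epsilon>) x + snd h * dy (\<Psi> \<epsilon>) x)) (at x)" for x
        unfolding \<Psi>_def eval_def dx_trig_series[OF exp_decay_coeff] dy_trig_series[OF exp_decay_coeff]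
        by (intro trig_series_has_derivative exp_decay_coeff)
      have Ed: "(trig_series c has_derivative
          (\<lambda>h. fst h * (- dx (\<Psi> \<epsilon>) x) + snd h * (- sin (snd x) - dy (\<Psi> \<epsilon>) x))) (at x)" for x
        unfolding E by (auto intro!: derivative_eq_intros \<Psi>d simp: algebra_simps)
      have x: "(\<lambda>x. snd (kolmogorov_flow x - grad_perp (\<Psi> \<epsilon>) x)) = trig_series (dx_coeff c)"
        unfolding dx_trig_series[OF c, symmetric]
        by (rule ext) (simp add: dx_eqI[OF Ed] kolmogorov_flow_def grad_perp_def case_prod_unfold)
      have "trig_series d = (\<lambda>x. - trig_series (dy_coeff c) x)"
        by (rule ext) (simp add: trig_series_def d_def infsum_uminus[symmetric])
      then have y: "(\<lambda>x. fst (kolmogorov_flow x - grad_perp (\<Psi> \<epsilon>) x)) = trig_series d"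
        unfolding dy_trig_series[OF c, symmetric]
        by (auto simp: dy_eqI[OF Ed] kolmogorov_flow_def grad_perp_def case_prod_unfold)
      have "cmod (dx_coeff c k) \<le> freq_l1 k * \<bar>coeff (cos_y - \<psi> \<epsilon>) k\<bar>"
        "cmod (d k) \<le> freq_l1 k * \<bar>coeff (cos_y - \<psi> \<epsilon>) k\<bar>" for k
        unfolding d_def dx_coeff_def dy_coeff_def c_def norm_minus_cancel norm_mult norm_of_real
        by (auto simp: freq_l1_def intro!: mult_right_mono)
      moreover have "dx_coeff c (- k) = cnj (dx_coeff c k)" "d (- k) = cnj (d k)" for k
        by (simp_all add: d_def dx_coeff_def dy_coeff_def c_def)
      moreover have "norm (cos_y - \<psi> \<epsilon>) / (1 - s) < \<delta>"
      proof -
        have "norm (cos_y - \<psi> \<epsilon>) \<le> C * \<epsilon>"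
          using \<epsilon> by (intro close) (auto simp: e_def)
        also have "C * \<epsilon> < \<delta> * (1 - s)"
          using \<epsilon>(2) \<delta>0(2) by (auto simp: e_def field_simps)
        finally show ?thesis
          using s by (simp add: field_simps)
      qed
      ultimately show ?thesis
        unfolding x y
        using gevrey_derivative[of "dx_coeff c" "cos_y - \<psi> \<epsilon>" s] gevrey_derivative[of d "cos_y - \<psi> \<epsilon>" s] s
        by (meson le_less_trans)
    qed
    ultimately show ?thesis
      using eventually_at_right_real[of 0 e] by (auto elim!: eventually_mono)
  qed
  \<comment> \<open>The Gevrey rate 1 is the rate of the weight in the norm of
    \<open>cos_alg\<close>.\<close>
  show ?thesis
    by (rule exI[of _ \<epsilon>0], rule conjI[OF \<epsilon>0], rule exI[of _ 1], rule conjI[OF zero_less_one],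
        rule exI[of _ C], rule conjI[OF \<delta>0(2)], rule exI[of _ \<Psi>], rule exI[of _ F])
      (use main inner euler near in blast)
qed

end
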